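(* Let $d\ge 3$ be an integer and let $\psi\in\Psi_d$ have $d$-Schoenberg sequence $(b_{n,d})_{n\in\mathbb{N}_0}$. Put $$c(d):=\sum_{n=0}^\infty b_{n,d}\frac{(-1)^n(d-2)}{(n+1)(n+d-2)}.$$ (a) The mont\'ee $I_S\psi$ of $\psi$ is well-defined and $I_S\psi\in\Psi_{d-2}$ if and only if $c(d)\ge 0$. In this case, $I_S\psi\in\Psi_{d-2}$ has $(d-2)$-Schoenberg sequence $(a_{n,d-2})_{n\in\mathbb{N}_0}$ with $$a_{0,d-2}=\frac{c(d)}{G_1},\qquad a_{n,d-2}=\frac{(d-2)\,b_{n-1,d}}{n(n+d-3)\,G_1}\quad (n\ge 1),$$ where $G_1:=2(d-2)\sum_{n=0}^\infty \dfrac{b_{2n,d}}{(2n+1)(2n+d-2)}$. (b) The condition $c(d)\ge 0$ is equivalent to $\int_0^\pi f_d(\theta)\psi(\theta)\,\mathrm{d}\theta\ge 0$, where, for $\theta \in [0,\pi]$, $$f_d(\theta)=\begin{cases}\dfrac{1}{\pi}\theta\sin\theta-\cos\theta\displaystyle\sum_{\ell=1}^{(d-3)/2}(\sin\theta)^{2\ell}\,\frac{\Gamma(\ell)^2\,2^{2\ell-2}}{\pi\,\Gamma(2\ell)}, & d\ge 3\text{ odd},\\[2ex] \dfrac12\sin\theta-\cos\theta\displaystyle\sum_{\ell=1}^{d/2-1}(\sin\theta)^{2\ell-1}\,\frac{\Gamma\big(\frac{2\ell-1}{2}\big)^2\,2^{2\ell-3}}{\pi\,\Gamma(2\ell-1)},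 & d\ge 4\text{ even},\end{cases}$$ and, for $\theta\ne\pi/2$, also $$f_d(\theta)=\sin\theta\,\mathbf{1}\{\theta>\pi/2\}+\frac{2^{d-3}\,\Gamma\big(\frac{d-1}{2}\big)^2}{\pi\,\Gamma(d-1)}\cos\theta\,(\sin\theta)^{d-1}\,{}_2F_1\Big(1,\frac{d-1}{2},\frac d2,(\sin\theta)^2\Big).$$ (c) A sufficient condition for $c(d)\ge 0$ to hold is that $\psi\ge 0$.
   Context: For an integer $d\ge 1$, $\mathbb{S}^d=\{x\in\mathbb{R}^{d+1}:\|x\|=1\}$ and $\theta(x,y)=\arccos(\langle x,y\rangle)$ for $x,y\in\mathbb{S}^d$. A function $g:\mathbb{S}^d\times\mathbb{S}^d\to\mathbb{R}$ is positive definite if $\sum_{i=1}^n\sum_{j=1}^n c_ic_j g(x_i,x_j)\ge 0$ for all $n \ge 1$, $x_i\in\mathbb{S}^d$, $c_i\in\mathbb{R}$. $\Psi_d$ is the class of continuous $\psi:[0,\pi]\to\mathbb{R}$ with $\psi(0)=1$ such that $g(x,y)=\psi(\theta(x,y))$ is positive definite on $\mathbb{S}^d$. Gegenbauer polynomials: for $\lambda>0$, $(1+r^2-2r\cos\theta)^{-\lambda}=\sum_{n=0}^\infty r^nC_n^\lambda(\cos\theta)$ for $r\in(-1,1)$, $\theta\in[0,\pi]$; for $\lambda=0$, $C_n^0(\cos\theta)=\cos(n\theta)$. By Schoenberg's theorem, $\psi\in\Psi_d$ if and only if $\psi(\theta)=\sum_{n=0}^\infty b_{n,d}\,C_n^{(d-1)/2}(\cos\theta)/C_n^{(d-1)/2}(1)$,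 $\theta\in[0,\pi]$, with coefficients $b_{n,d}\ge 0$, $\sum_{n=0}^\infty b_{n,d}=1$; the (unique) sequence $(b_{n,d})_{n\in\mathbb{N}_0}$ is the $d$-Schoenberg sequence of $\psi$. Mont\'ee on spheres: for $\psi:[0,\pi]\to\mathbb{R}$ such that $\int_0^\pi\sin(\beta)\psi(\beta)\,\mathrm{d}\beta$ is finite and non-zero (this is what "well-defined" means), $$I_S\psi(\theta):=\frac{\int_\theta^\pi\sin(\beta)\psi(\beta)\,\mathrm{d}\beta}{\int_0^\pi\sin(\beta)\psi(\beta)\,\mathrm{d}\beta},\quad\theta\in[0,\pi].$$ ${}_2F_1(a,b,c,z)$ is the Gauss hypergeometric function, $\Gamma$ the Gamma function, $\mathbf{1}\{\cdot\}$ the indicator; empty sums are $0$. *)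

theory Defs
  imports "HOL-Analysis.Analysis"
begin

(* The dimension d varies within the theorem, so points of R^(d+1) are functions nat => real
   supported on {..d}; topspace (nsphere d) is the unit sphere in that representation. *)

definition geodesic_dist :: "nat \<Rightarrow> (nat \<Rightarrow> real) \<Rightarrow> (nat \<Rightarrow> real) \<Rightarrow> real" where
  "geodesic_dist d x y = arccos (\<Sum>k\<le>d. x k * y k)"

definition positive_definite_on_sphere ::
  "nat \<Rightarrow> ((nat \<Rightarrow> real) \<Rightarrow> (nat \<Rightarrow> real) \<Rightarrow> real) \<Rightarrow> bool" where
  "positive_definite_on_sphere d g \<longleftrightarrow>
     (\<forall>n\<ge>1. \<forall>(x :: nat \<Rightarrow> nat \<Rightarrow> real) (c :: nat \<Rightarrow> real).
        (\<forall>i\<in>{1..n}. x i \<in> topspace (nsphere d)) \<longrightarrow>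
        (\<Sum>i=1..n. \<Sum>j=1..n. c i * c j * g (x i) (x j)) \<ge> 0)"

(* Functions on [0,pi] are total functions whose values off {0..pi} are irrelevant. *)

definition Psi :: "nat \<Rightarrow> (real \<Rightarrow> real) set" where
  "Psi d = {\<psi>. continuous_on {0..pi} \<psi> \<and> \<psi> 0 = 1 \<and>
                positive_definite_on_sphere d (\<lambda>x y. \<psi> (geodesic_dist d x y))}"

(* For lambda > 0 the sequence (C_n^lambda(t))_n is the coefficient sequence of the generating
   function, which determines it uniquely for every t in [-1,1]. Only lambda \<ge> 0 and
   t in [-1,1] are meaningful. *)

definition gegenbauer :: "real \<Rightarrow> nat \<Rightarrow> real \<Rightarrow> real" where
  "gegenbauer l n t =
     (if l = 0 then cos (real n * arccos t)
      else (THE C. \<forall>r\<in>{-1<..<1}.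
              (\<lambda>m. r ^ m * C m) sums ((1 + r\<^sup>2 - 2 * r * t) powr (- l))) n)"

definition has_schoenberg_seq :: "nat \<Rightarrow> (real \<Rightarrow> real) \<Rightarrow> (nat \<Rightarrow> real) \<Rightarrow> bool" where
  "has_schoenberg_seq d \<psi> b \<longleftrightarrow>
     (\<forall>n. b n \<ge> 0) \<and> b sums 1 \<and>
     (\<forall>\<theta>\<in>{0..pi}.
        (\<lambda>n. b n * (gegenbauer ((real d - 1) / 2) n (cos \<theta>) / gegenbauer ((real d - 1) / 2) n 1))
          sums \<psi> \<theta>)"

definition montee_well_defined :: "(real \<Rightarrow> real) \<Rightarrow> bool" where
  "montee_well_defined \<psi> \<longleftrightarrow>
     (\<lambda>\<beta>. sin \<beta> * \<psi> \<beta>) absolutely_integrable_on {0..pi} \<and>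
     integral {0..pi} (\<lambda>\<beta>. sin \<beta> * \<psi> \<beta>) \<noteq> 0"

definition montee :: "(real \<Rightarrow> real) \<Rightarrow> real \<Rightarrow> real" where
  "montee \<psi> \<theta> =
     integral {\<theta>..pi} (\<lambda>\<beta>. sin \<beta> * \<psi> \<beta>) / integral {0..pi} (\<lambda>\<beta>. sin \<beta> * \<psi> \<beta>)"

definition schoenberg_c :: "nat \<Rightarrow> (nat \<Rightarrow> real) \<Rightarrow> real" where
  "schoenberg_c d b =
     (\<Sum>n. b n * ((-1) ^ n * (real d - 2) / ((real n + 1) * (real n + real d - 2))))"

definition schoenberg_G1 :: "nat \<Rightarrow> (nat \<Rightarrow> real) \<Rightarrow> real" where
  "schoenberg_G1 d b =
     2 * (real d - 2) *
       (\<Sum>n. b (2 * n) / ((2 * real n + 1) * (2 * real n + real d - 2)))"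

definition montee_seq :: "nat \<Rightarrow> (nat \<Rightarrow> real) \<Rightarrow> nat \<Rightarrow> real" where
  "montee_seq d b n =
     (if n = 0 then schoenberg_c d b / schoenberg_G1 d b
      else (real d - 2) * b (n - 1) / (real n * (real n + real d - 3) * schoenberg_G1 d b))"

(* Gauss series; meaningful for norm z < 1 *)
definition hypergeometric_2F1 :: "real \<Rightarrow> real \<Rightarrow> real \<Rightarrow> real \<Rightarrow> real" where
  "hypergeometric_2F1 a b c z = eval_fps (fps_hypergeo [a, b] [c] 1) z"

definition montee_weight :: "nat \<Rightarrow> real \<Rightarrow> real" where
  "montee_weight d \<theta> =
     (if odd d then
        1 / pi * \<theta> * sin \<theta>
        - cos \<theta> * (\<Sum>l = 1..(d - 3) div 2.
            sin \<theta> ^ (2 * l) *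
            ((Gamma (real l))\<^sup>2 * 2 powi (2 * int l - 2) / (pi * Gamma (2 * real l))))
      else
        1 / 2 * sin \<theta>
        - cos \<theta> * (\<Sum>l = 1..d div 2 - 1.
            sin \<theta> ^ (2 * l - 1) *
            ((Gamma ((2 * real l - 1) / 2))\<^sup>2 * 2 powi (2 * int l - 3) /
              (pi * Gamma (2 * real l - 1)))))"

end

(* Write P_n for the Gegenbauer polynomial with parameter (m-1)/2 normalised by P_n(1) = 1. The kernel
   P_n(<x,y>) on the m-sphere is a Gram matrix: the solid zonal harmonics Z_x are reproducing for harmonic
   polynomials under the Fischer pairing, so <Z_x, Z_y> is a positive multiple of Z_x(y). Hence a series
   with nonnegative coefficients is positive definite. Conversely, if all coefficients but the constant one
   are nonnegative and the series is positive definite, then the constant one is nonnegative too: a harmonic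
   polynomial vanishing at 0 cannot be positive on the whole sphere, so K points can be chosen greedily such
   that the non-constant part contributes only O(K) to the double sum, against K^2 a_0.

   Integrating sin * P_n termwise lowers the parameter by one and raises the degree by one; this gives the
   series of the montee with constant coefficient c(d)/G_1, and G_1 = c(d) + (a positive number).
   The weight f_d is sin times the distribution function of the density proportional to sin^(d-3), and
   integration by parts against it shows that the integral of f_d psi is c(d). *)

theory Submission
  imports Defs
begin

subsection \<open>Normalised Gegenbauer polynomials\<close>

text \<open>The hard point is the "only if" of (a): membership in \<open>Psi (d - 2)\<close> must
  force the sign of one coefficient. Averaging over the sphere would isolate it; the greedy points
  are a discrete substitute, so the argument stays with finite point sets and polynomials. The
  greedy step handles finitely many degrees only, so the tail of the series is estimated separately.

  The weight f_d comes from the same average. On the (d-2)-sphere the constant coefficient of a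
  zonal series is its mean against the density proportional to sin^(d-3). For the numerator of the
  montee, the integral of sin psi over [\<theta>, pi], this mean is c(d), and exchanging the order
  of integration replaces the density by its distribution function. The two closed forms of f_d are
  two evaluations of that function: by its reduction formula and by a hypergeometric series.

  The bound |P_n| <= 1, behind every convergence claim for series in P_n, also comes from the Gram
  matrix, applied to two points.\<close>

text \<open>The quotients \<open>C\<^sub>n\<^sup>l(t) / C\<^sub>n\<^sup>l(1)\<close>; in this normalisation the recurrence also covers \<open>l = 0\<close>.\<close>

fun norm_gegenbauer :: "real \<Rightarrow> nat \<Rightarrow> real \<Rightarrow> real" where
  "norm_gegenbauer l 0 t = 1"
| "norm_gegenbauer l (Suc 0) t = t"
| "norm_gegenbauer l (Suc (Suc n)) t =
     (2 * (real n + 1 + l) * t * norm_gegenbauer l (Suc n) t - (real n + 1) * norm_gegenbauer l n t) / (real n + 1 + 2 * l)"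

lemma norm_gegenbauer_rec:
  assumes "l \<ge> 0"
  shows "(real n + 1 + 2 * l) * norm_gegenbauer l (Suc (Suc n)) t =
           2 * (real n + 1 + l) * t * norm_gegenbauer l (Suc n) t - (real n + 1) * norm_gegenbauer l n t"
  using assms by (simp add: add_nonneg_eq_0_iff)

declare norm_gegenbauer.simps(3) [simp del]

text \<open>At \<open>n = 0\<close> the factor \<open>real n\<close> removes the term with the
  truncated index \<open>n - 1\<close>, so the low degrees need no separate treatment later.\<close>

lemma norm_gegenbauer_rec':
  assumes "l \<ge> 0"
  shows "(real n + 2 * l) * norm_gegenbauer l (Suc n) t = 2 * (real n + l) * t * norm_gegenbauer l n t - real n * norm_gegenbauer l (n - 1) t"
proof (cases n)
  case (Suc k)
  then show ?thesis
    using norm_gegenbauer_rec[OF assms, of k t] by (simp add: algebra_simps)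
qed simp

lemma norm_gegenbauer_1: "l \<ge> 0 \<Longrightarrow> norm_gegenbauer l n 1 = 1"
proof (induction n rule: induct_nat_012)
  case (ge2 n)
  then show ?case
    by (simp add: norm_gegenbauer.simps(3) field_simps) 
qed auto

lemma norm_gegenbauer_minus: "norm_gegenbauer l n (- t) = (-1) ^ n * norm_gegenbauer l n t"
proof (induction n rule: induct_nat_012)
  case (ge2 n)
  then show ?case
    by (simp add: norm_gegenbauer.simps(3) field_simps)
qed auto

text \<open>Parameter 0 belongs to the circle, the sphere of the montee when
  \<open>d = 3\<close>.\<close>

lemma norm_gegenbauer_0_cos: "norm_gegenbauer 0 n (cos \<theta>) = cos (real n * \<theta>)"
proof (induction n rule: induct_nat_012)
  case (ge2 n)
  have "cos (real (Suc (Suc n)) * \<theta>) + cos (real n * \<theta>) = 2 * cos \<theta> * cos (real (Suc n) * \<theta>)"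
    by (subst cos_plus_cos) (simp add: algebra_simps add_divide_distrib diff_divide_distrib)
  moreover have "(real n + 1) * norm_gegenbauer 0 (Suc (Suc n)) (cos \<theta>) = (real n + 1) * (2 * cos \<theta> * norm_gegenbauer 0 (Suc n) (cos \<theta>) - norm_gegenbauer 0 n (cos \<theta>))"
    using norm_gegenbauer_rec[of 0 n "cos \<theta>"] by (simp add: algebra_simps)
  hence "norm_gegenbauer 0 (Suc (Suc n)) (cos \<theta>) = 2 * cos \<theta> * norm_gegenbauer 0 (Suc n) (cos \<theta>) - norm_gegenbauer 0 n (cos \<theta>)"
    by (subst (asm) mult_left_cancel) auto
  ultimately show ?case using ge2 by simp
qed auto

text \<open>The connection formula between neighbouring parameters; with the recurrences it carries
  every later change of parameter.\<close>

lemma norm_gegenbauer_Suc_index: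
  assumes "l \<ge> 0"
  shows "(2 * l + 1) * norm_gegenbauer l (Suc n) t = (2 * l + 1 + real n) * t * norm_gegenbauer (l + 1) n t - real n * norm_gegenbauer (l + 1) (n - 1) t"
proof (induction n rule: induct_nat_012)
  case (ge2 n)
  define P where "P = (\<lambda>k. norm_gegenbauer l k t)"
  define R where "R = (\<lambda>k. norm_gegenbauer (l + 1) k t)"
  have r: "(real n + 2 + 2 * l) * P (Suc (Suc (Suc n))) = 2 * (real n + 2 + l) * t * P (Suc (Suc n)) - (real n + 2) * P (Suc n)"
    using norm_gegenbauer_rec[of l "Suc n" t] assms by (simp add: P_def algebra_simps)
  have r2: "(real n + 3 + 2 * l) * R (Suc (Suc n)) = 2 * (real n + 2 + l) * t * R (Suc n) - (real n + 1) * R n"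
    using norm_gegenbauer_rec[of "l + 1" n t] assms by (simp add: R_def algebra_simps)
  have i1: "(2 * l + 1) * P (Suc n) = (2 * l + 1 + real n) * t * R n - real n * R (n - 1)"
    using ge2(1) by (simp add: P_def R_def)
  have i2: "(2 * l + 1) * P (Suc (Suc n)) = (2 * l + 2 + real n) * t * R (Suc n) - (real n + 1) * R n"
    using ge2(2) by (simp add: P_def R_def algebra_simps)
  have r3: "(real n + 2 + 2 * l) * R (Suc n) = 2 * (real n + 1 + l) * t * R n - real n * R (n - 1)"
    using norm_gegenbauer_rec'[of "l + 1" n t] assms by (simp add: R_def algebra_simps)
  \<comment> \<open>After multiplication by the denominator of the recurrence for \<open>P\<close>,
    the claim is a polynomial consequence of the two induction hypotheses and of the recurrence for
    \<open>R\<close> at two consecutive degrees.\<close>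
  have "(real n + 2 + 2 * l) * ((2 * l + 1) * P (Suc (Suc (Suc n)))) =
          (real n + 2 + 2 * l) * ((2 * l + 3 + real n) * t * R (Suc (Suc n)) - (real n + 2) * R (Suc n))"
    using r r2 i1 i2 r3 by algebra
  moreover have "real n + 2 + 2 * l \<noteq> 0" using assms by linarith
  ultimately have "(2 * l + 1) * P (Suc (Suc (Suc n))) = (2 * l + 3 + real n) * t * R (Suc (Suc n)) - (real n + 2) * R (Suc n)"
    by simp
  then show ?case by (simp add: P_def R_def algebra_simps)
qed (use assms in \<open>auto simp: norm_gegenbauer.simps field_simps\<close>)

text \<open>The constant is the derivative at 1, because the polynomial on the right is normalised
  to 1 there.\<close>

lemma norm_gegenbauer_has_derivative:
  assumes "l \<ge> 0"
  shows "(norm_gegenbauer l n has_real_derivative real n * (real n + 2 * l) / (1 + 2 * l) * norm_gegenbauer (l + 1) (n - 1) t) (at t)"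
proof (induction n rule: induct_nat_012)
  case 0
  have "norm_gegenbauer l 0 = (\<lambda>_. 1)" by auto
  then show ?case by simp
next
  case 1
  have "norm_gegenbauer l (Suc 0) = (\<lambda>t. t)" by auto
  then show ?case using assms by simp
next
  case (ge2 n)
  define R where "R = (\<lambda>k. norm_gegenbauer (l + 1) k t)"
  have e: "norm_gegenbauer l (Suc (Suc n)) = (\<lambda>t. (2 * (real n + 1 + l) * t * norm_gegenbauer l (Suc n) t - (real n + 1) * norm_gegenbauer l n t) / (real n + 1 + 2 * l))"
    by (auto simp: norm_gegenbauer.simps)
  have nz: "real n + 1 + 2 * l \<noteq> 0" "1 + 2 * l \<noteq> 0" using assms by linarith+
  have r3: "(real n + 2 + 2 * l) * R (Suc n) = 2 * (real n + 1 + l) * t * R n - real n * R (n - 1)"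
    using norm_gegenbauer_rec'[of "l + 1" n t] assms by (simp add: R_def algebra_simps)
  have j: "(1 + 2 * l) * norm_gegenbauer l (Suc n) t = (2 * l + 1 + real n) * t * R n - real n * R (n - 1)"
    using norm_gegenbauer_Suc_index[OF assms, of n t] by (simp add: R_def algebra_simps)
  define A where "A = (real n + 1) * (real n + 1 + 2 * l) / (1 + 2 * l) * R n"
  define B where "B = real n * (real n + 2 * l) / (1 + 2 * l) * R (n - 1)"
  have A: "(1 + 2 * l) * A = (real n + 1) * (real n + 1 + 2 * l) * R n"
    and B: "(1 + 2 * l) * B = real n * (real n + 2 * l) * R (n - 1)"
    using nz by (simp_all add: A_def B_def)
  have "(1 + 2 * l) * (2 * (real n + 1 + l) * (norm_gegenbauer l (Suc n) t + t * A) - (real n + 1) * B)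
     = (real n + 2) * (real n + 2 + 2 * l) * (real n + 1 + 2 * l) * R (Suc n)"
    using j A B r3 by algebra
  hence "(2 * (real n + 1 + l) * (norm_gegenbauer l (Suc n) t + t * A) - (real n + 1) * B) / (real n + 1 + 2 * l)
     = (real n + 2) * (real n + 2 + 2 * l) / (1 + 2 * l) * R (Suc n)"
    using nz by (simp add: divide_simps mult_ac)
  moreover have D1: "(norm_gegenbauer l (Suc n) has_real_derivative A) (at t)"
    using ge2(2) by (simp add: A_def R_def algebra_simps)
  moreover have D2: "(norm_gegenbauer l n has_real_derivative B) (at t)"
    using ge2(1) by (simp add: B_def R_def)
  moreover have "(norm_gegenbauer l (Suc (Suc n)) has_real_derivative
      (2 * (real n + 1 + l) * (norm_gegenbauer l (Suc n) t + t * A) - (real n + 1) * B) / (real n + 1 + 2 * l)) (at t)"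
  proof -
    have "((\<lambda>t. 2 * (real n + 1 + l) * (t * norm_gegenbauer l (Suc n) t) - (real n + 1) * norm_gegenbauer l n t) has_real_derivative
      2 * (real n + 1 + l) * (t * A + 1 * norm_gegenbauer l (Suc n) t) - (real n + 1) * B) (at t)"
      by (intro DERIV_diff DERIV_cmult DERIV_mult' DERIV_ident D1 D2)
    from DERIV_cdivide[OF this, of "real n + 1 + 2 * l"] show ?thesis
      unfolding e by (simp add: mult_ac add_ac)
  qed
  ultimately show ?case by (simp add: R_def algebra_simps)
qed

text \<open>Read with the derivative formula, this is (1 - t^2) P_(n+1)' = (n+1) (P_n - t P_(n+1));
  it eliminates a derivative in \<open>orthogonality_primitive\<close>.\<close>

lemma norm_gegenbauer_ode:
  assumes "l \<ge> 0"
  shows "(1 - t\<^sup>2) * (real (Suc n) + 2 * l) * norm_gegenbauer (l + 1) n t = (2 * l + 1) * (norm_gegenbauer l n t - t * norm_gegenbauer l (Suc n) t)"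
proof (cases n)
  case 0
  then show ?thesis by (simp add: algebra_simps power2_eq_square)
next
  case (Suc k)
  define R where "R = (\<lambda>k. norm_gegenbauer (l + 1) k t)"
  have "(2 * l + 1) * norm_gegenbauer l (Suc (Suc k)) t = (2 * l + 2 + real k) * t * R (Suc k) - (real k + 1) * R k"
    using norm_gegenbauer_Suc_index[OF assms, of "Suc k" t] by (simp add: R_def algebra_simps)
  moreover have "(2 * l + 1) * norm_gegenbauer l (Suc k) t = (2 * l + 1 + real k) * t * R k - real k * R (k - 1)"
    using norm_gegenbauer_Suc_index[OF assms, of k t] by (simp add: R_def algebra_simps)
  moreover have "(real k + 2 + 2 * l) * R (Suc k) = 2 * (real k + 1 + l) * t * R k - real k * R (k - 1)"
    using norm_gegenbauer_rec'[of "l + 1" k t] assms by (simp add: R_def algebra_simps)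
  ultimately have "(1 - t\<^sup>2) * (real k + 2 + 2 * l) * R (Suc k) = (2 * l + 1) * (norm_gegenbauer l (Suc k) t - t * norm_gegenbauer l (Suc (Suc k)) t)"
    by algebra
  then show ?thesis using Suc by (simp add: R_def algebra_simps)
qed

subsection \<open>The Fischer pairing\<close>

text \<open>A polynomial in \<open>y\<^sub>0, \<dots>, y\<^sub>m\<close> is represented by its coefficients, a function on exponent
  vectors \<open>nat \<Rightarrow> nat\<close>. The operators below act on arbitrary coefficient functions; only the pairing and
  the evaluation restrict to exponents of a fixed total degree.\<close>

definition multiindices :: "nat \<Rightarrow> nat \<Rightarrow> (nat \<Rightarrow> nat) set" where
  "multiindices m n = {\<alpha>. (\<forall>i>m. \<alpha> i = 0) \<and> (\<Sum>i\<le>m. \<alpha> i) = n}"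

definition mult_var :: "nat \<Rightarrow> ((nat \<Rightarrow> nat) \<Rightarrow> real) \<Rightarrow> (nat \<Rightarrow> nat) \<Rightarrow> real" where
  "mult_var i p \<alpha> = (if \<alpha> i = 0 then 0 else p (\<alpha>(i := \<alpha> i - 1)))"

definition partial :: "nat \<Rightarrow> ((nat \<Rightarrow> nat) \<Rightarrow> real) \<Rightarrow> (nat \<Rightarrow> nat) \<Rightarrow> real" where
  "partial i p \<alpha> = real (Suc (\<alpha> i)) * p (\<alpha>(i := Suc (\<alpha> i)))"

definition mult_linear :: "nat \<Rightarrow> (nat \<Rightarrow> real) \<Rightarrow> ((nat \<Rightarrow> nat) \<Rightarrow> real) \<Rightarrow> (nat \<Rightarrow> nat) \<Rightarrow> real" where
  "mult_linear m x p \<alpha> = (\<Sum>i\<le>m. x i * mult_var i p \<alpha>)"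

definition mult_norm2 :: "nat \<Rightarrow> ((nat \<Rightarrow> nat) \<Rightarrow> real) \<Rightarrow> (nat \<Rightarrow> nat) \<Rightarrow> real" where
  "mult_norm2 m p \<alpha> = (\<Sum>i\<le>m. mult_var i (mult_var i p) \<alpha>)"

definition dir_deriv :: "nat \<Rightarrow> (nat \<Rightarrow> real) \<Rightarrow> ((nat \<Rightarrow> nat) \<Rightarrow> real) \<Rightarrow> (nat \<Rightarrow> nat) \<Rightarrow> real" where
  "dir_deriv m x p \<alpha> = (\<Sum>i\<le>m. x i * partial i p \<alpha>)"

definition laplacian :: "nat \<Rightarrow> ((nat \<Rightarrow> nat) \<Rightarrow> real) \<Rightarrow> (nat \<Rightarrow> nat) \<Rightarrow> real" where
  "laplacian m p \<alpha> = (\<Sum>i\<le>m. partial i (partial i p) \<alpha>)"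

definition monomial :: "nat \<Rightarrow> (nat \<Rightarrow> real) \<Rightarrow> (nat \<Rightarrow> nat) \<Rightarrow> real" where
  "monomial m y \<alpha> = (\<Prod>i\<le>m. y i ^ \<alpha> i)"

definition poly_eval :: "nat \<Rightarrow> nat \<Rightarrow> ((nat \<Rightarrow> nat) \<Rightarrow> real) \<Rightarrow> (nat \<Rightarrow> real) \<Rightarrow> real" where
  "poly_eval m n p y = (\<Sum>\<alpha>\<in>multiindices m n. p \<alpha> * monomial m y \<alpha>)"

definition mfact :: "nat \<Rightarrow> (nat \<Rightarrow> nat) \<Rightarrow> real" where
  "mfact m \<alpha> = (\<Prod>i\<le>m. fact (\<alpha> i))"

text \<open>This is p(D) q for homogeneous p and q of the same degree. The factorial weights are
  what makes multiplication by a variable adjoint to differentiation in it.\<close>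

definition fischer :: "nat \<Rightarrow> nat \<Rightarrow> ((nat \<Rightarrow> nat) \<Rightarrow> real) \<Rightarrow> ((nat \<Rightarrow> nat) \<Rightarrow> real) \<Rightarrow> real" where
  "fischer m n p q = (\<Sum>\<alpha>\<in>multiindices m n. mfact m \<alpha> * p \<alpha> * q \<alpha>)"

lemma finite_multiindices [simp]: "finite (multiindices m n)"
proof (rule finite_subset)
  show "multiindices m n \<subseteq> {f. \<forall>i. (i \<in> {..m} \<longrightarrow> f i \<in> {..n}) \<and> (i \<notin> {..m} \<longrightarrow> f i = 0)}"
  proof
    fix \<alpha> assume a: "\<alpha> \<in> multiindices m n"
    have "\<alpha> i \<le> n" if "i \<le> m" for i
      using a that member_le_sum[of i "{..m}" \<alpha>] by (auto simp: multiindices_def)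
    thus "\<alpha> \<in> {f. \<forall>i. (i \<in> {..m} \<longrightarrow> f i \<in> {..n}) \<and> (i \<notin> {..m} \<longrightarrow> f i = 0)}"
      using a by (auto simp: multiindices_def)
  qed
qed (rule finite_set_of_finite_funs; simp)

lemma sum_fun_upd:
  fixes \<alpha> :: "nat \<Rightarrow> nat"
  assumes "i \<le> m"
  shows "(\<Sum>k\<le>m. (\<alpha>(i := v)) k) + \<alpha> i = (\<Sum>k\<le>m. \<alpha> k) + v"
proof -
  have "(\<Sum>k\<le>m. (\<alpha>(i := v)) k) = v + (\<Sum>k\<in>{..m}-{i}. \<alpha> k)"
    using assms by (subst sum.remove[of _ i]) auto
  moreover have "(\<Sum>k\<le>m. \<alpha> k) = \<alpha> i + (\<Sum>k\<in>{..m}-{i}. \<alpha> k)"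
    using assms by (subst sum.remove[of _ i]) auto
  ultimately show ?thesis by simp
qed

text \<open>The reindexing behind both the adjointness of \<open>mult_var\<close> and
  \<open>partial\<close> and the differentiation of \<open>poly_eval\<close>.\<close>

lemma sum_multiindices_raise:
  fixes f :: "(nat \<Rightarrow> nat) \<Rightarrow> real"
  assumes "i \<le> m"
  shows "(\<Sum>\<alpha>\<in>multiindices m (Suc n). if \<alpha> i = 0 then 0 else f \<alpha>) =
         (\<Sum>\<beta>\<in>multiindices m n. f (\<beta>(i := Suc (\<beta> i))))"
proof -
  have "(\<Sum>\<alpha>\<in>multiindices m (Suc n). if \<alpha> i = 0 then 0 else f \<alpha>) =
        (\<Sum>\<alpha>\<in>{\<alpha> \<in> multiindices m (Suc n). \<alpha> i \<noteq> 0}. f \<alpha>)"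
    by (intro sum.mono_neutral_cong_right) auto
  also have "\<dots> = (\<Sum>\<beta>\<in>multiindices m n. f (\<beta>(i := Suc (\<beta> i))))"
  proof (rule sum.reindex_bij_witness[of _ "\<lambda>\<beta>. \<beta>(i := Suc (\<beta> i))" "\<lambda>\<alpha>. \<alpha>(i := \<alpha> i - 1)"])
    fix \<alpha> assume a: "\<alpha> \<in> {\<alpha> \<in> multiindices m (Suc n). \<alpha> i \<noteq> 0}"
    show "\<alpha>(i := \<alpha> i - 1) \<in> multiindices m n"
      using a assms sum_fun_upd[OF assms, of \<alpha> "\<alpha> i - 1"] by (auto simp: multiindices_def)
  next
    fix \<beta> assume a: "\<beta> \<in> multiindices m n"
    show "\<beta>(i := Suc (\<beta> i)) \<in> {\<alpha> \<in> multiindices m (Suc n). \<alpha> i \<noteq> 0}"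
      using a assms sum_fun_upd[OF assms, of \<beta> "Suc (\<beta> i)"] by (auto simp: multiindices_def)
  qed auto
  finally show ?thesis .
qed

lemma mfact_Suc: "i \<le> m \<Longrightarrow> mfact m (\<alpha>(i := Suc (\<alpha> i))) = real (Suc (\<alpha> i)) * mfact m \<alpha>"
  unfolding mfact_def
  by (subst (1 2) prod.remove[of _ i]) (auto intro!: prod.cong)

lemma mfact_pos: "mfact m \<alpha> > 0"
  by (auto simp: mfact_def intro!: prod_pos)

lemma monomial_Suc: "i \<le> m \<Longrightarrow> monomial m y (\<alpha>(i := Suc (\<alpha> i))) = y i * monomial m y \<alpha>"
  unfolding monomial_def
  by (subst (1 2) prod.remove[of _ i]) (auto intro!: prod.cong)

section \<open>Adjointness of multiplication and differentiation\<close>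

lemma fischer_mult_var:
  assumes "i \<le> m"
  shows "fischer m (Suc n) (mult_var i q) p = fischer m n q (partial i p)"
proof -
  have "fischer m (Suc n) (mult_var i q) p =
        (\<Sum>\<alpha>\<in>multiindices m (Suc n). if \<alpha> i = 0 then 0 else mfact m \<alpha> * q (\<alpha>(i := \<alpha> i - 1)) * p \<alpha>)"
    unfolding fischer_def mult_var_def by (intro sum.cong) auto
  also have "\<dots> = fischer m n q (partial i p)"
    by (subst sum_multiindices_raise[OF assms])
       (auto simp: fischer_def partial_def mfact_Suc[OF assms] intro!: sum.cong)
  finally show ?thesis .
qed

lemma fischer_commute: "fischer m n p q = fischer m n q p"
  by (simp add: fischer_def mult_ac)

lemma fischer_sum_left: "fischer m n (\<lambda>\<alpha>. \<Sum>i\<in>A. f i * p i \<alpha>) q = (\<Sum>i\<in>A. f i * fischer m n (p i) q)"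
  unfolding fischer_def sum_distrib_left sum_distrib_right
  by (subst sum.swap) (simp add: mult_ac)

lemma fischer_sum_right: "fischer m n q (\<lambda>\<alpha>. \<Sum>i\<in>A. f i * p i \<alpha>) = (\<Sum>i\<in>A. f i * fischer m n q (p i))"
  by (simp add: fischer_commute[of _ _ q] fischer_sum_left)

lemma fischer_combine_left:
  "fischer m n (\<lambda>\<alpha>. a * p \<alpha> + b * q \<alpha>) r = a * fischer m n p r + b * fischer m n q r"
  by (simp add: fischer_def sum_distrib_left algebra_simps sum.distrib)

lemma fischer_combine_right:
  "fischer m n r (\<lambda>\<alpha>. a * p \<alpha> + b * q \<alpha>) = a * fischer m n r p + b * fischer m n r q"
  by (simp add: fischer_def sum_distrib_left algebra_simps sum.distrib)

lemma fischer_mult_linear: "fischer m (Suc n) (mult_linear m x q) p = fischer m n q (dir_deriv m x p)"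
proof -
  have "fischer m (Suc n) (mult_linear m x q) p = (\<Sum>i\<le>m. x i * fischer m (Suc n) (mult_var i q) p)"
    by (simp add: mult_linear_def[abs_def] fischer_sum_left)
  also have "\<dots> = fischer m n q (dir_deriv m x p)"
    by (simp add: dir_deriv_def[abs_def] fischer_sum_right fischer_mult_var)
  finally show ?thesis .
qed

lemma fischer_mult_norm2: "fischer m (Suc (Suc n)) (mult_norm2 m q) p = fischer m n q (laplacian m p)"
proof -
  have "fischer m (Suc (Suc n)) (mult_norm2 m q) p = (\<Sum>i\<le>m. 1 * fischer m (Suc (Suc n)) (mult_var i (mult_var i q)) p)"
    by (subst fischer_sum_left[symmetric]) (simp add: mult_norm2_def[abs_def])
  also have "\<dots> = (\<Sum>i\<le>m. 1 * fischer m n q (partial i (partial i p)))"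
    by (simp add: fischer_mult_var)
  also have "\<dots> = fischer m n q (laplacian m p)"
    by (subst fischer_sum_right[symmetric]) (simp add: laplacian_def[abs_def])
  finally show ?thesis .
qed

lemma fischer_cong:
  "(\<And>\<alpha>. \<alpha> \<in> multiindices m n \<Longrightarrow> p \<alpha> = p' \<alpha>) \<Longrightarrow> (\<And>\<alpha>. \<alpha> \<in> multiindices m n \<Longrightarrow> q \<alpha> = q' \<alpha>) \<Longrightarrow>
     fischer m n p q = fischer m n p' q'"
  by (auto simp: fischer_def intro!: sum.cong)

text \<open>The second argument is the coefficient function of exp(<y, .>). It is an eigenfunction
  of every \<open>partial i\<close>, so adjointness turns multiplication of a polynomial into
  multiplication of its value at \<open>y\<close>.\<close>

lemma poly_eval_eq_fischer: "poly_eval m n p y = fischer m n p (\<lambda>\<alpha>. monomial m y \<alpha> / mfact m \<alpha>)"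
  using mfact_pos[of m] by (auto simp: poly_eval_def fischer_def less_imp_neq[symmetric] intro!: sum.cong)

lemma partial_exp_kernel:
  assumes "i \<le> m"
  shows "partial i (\<lambda>\<alpha>. monomial m y \<alpha> / mfact m \<alpha>) = (\<lambda>\<alpha>. y i * (monomial m y \<alpha> / mfact m \<alpha>))"
  using mfact_pos[of m] assms by (auto simp: partial_def monomial_Suc mfact_Suc fun_eq_iff)

lemma fischer_scale_right: "fischer m n q (\<lambda>\<alpha>. a * p \<alpha>) = a * fischer m n q p"
  by (simp add: fischer_def sum_distrib_left algebra_simps)

lemma fischer_scale_left: "fischer m n (\<lambda>\<alpha>. a * p \<alpha>) q = a * fischer m n p q"
  by (simp add: fischer_def sum_distrib_left algebra_simps)

lemma poly_eval_mult_linear: "poly_eval m (Suc n) (mult_linear m x p) y = (\<Sum>i\<le>m. x i * y i) * poly_eval m n p y"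
proof -
  have "dir_deriv m x (\<lambda>\<alpha>. monomial m y \<alpha> / mfact m \<alpha>) = (\<lambda>\<alpha>. (\<Sum>i\<le>m. x i * y i) * (monomial m y \<alpha> / mfact m \<alpha>))"
    by (auto simp: dir_deriv_def partial_exp_kernel sum_distrib_left sum_distrib_right sum_divide_distrib mult_ac
        simp flip: times_divide_eq_right intro!: ext sum.cong)
  thus ?thesis
    by (simp only: poly_eval_eq_fischer fischer_mult_linear fischer_scale_right)
qed

lemma partial_scale: "partial i (\<lambda>\<alpha>. a * p \<alpha>) = (\<lambda>\<alpha>. a * partial i p \<alpha>)"
  by (auto simp: partial_def)

lemma poly_eval_mult_norm2: "poly_eval m (Suc (Suc n)) (mult_norm2 m p) y = (\<Sum>i\<le>m. y i ^ 2) * poly_eval m n p y"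
proof -
  define e where "e = (\<lambda>\<alpha>. monomial m y \<alpha> / mfact m \<alpha>)"
  have "partial i e = (\<lambda>\<alpha>. y i * e \<alpha>)" if "i \<le> m" for i
    unfolding e_def by (rule partial_exp_kernel[OF that])
  hence "laplacian m e = (\<lambda>\<alpha>. (\<Sum>i\<le>m. y i ^ 2) * e \<alpha>)"
    by (auto simp: laplacian_def partial_scale sum_distrib_right power2_eq_square mult.assoc intro!: ext sum.cong)
  thus ?thesis
    by (simp only: poly_eval_eq_fischer fischer_mult_norm2 fischer_scale_right flip: e_def)
qed

lemma fischer_self_nonneg: "fischer m n p p \<ge> 0"
  unfolding fischer_def by (intro sum_nonneg) (simp add: mfact_pos less_imp_le mult.assoc)

section \<open>Commutation relations of the operators\<close>

lemma partial_mult_var: "partial i (mult_var j p) = (\<lambda>\<alpha>. mult_var j (partial i p) \<alpha> + (if i = j then p \<alpha> else 0))"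
proof
  fix \<alpha>
  show "partial i (mult_var j p) \<alpha> = mult_var j (partial i p) \<alpha> + (if i = j then p \<alpha> else 0)"
  proof (cases "i = j")
    case True
    have "p (\<alpha>(i := 0)) = p \<alpha>" if "\<alpha> i = 0"
      using that by (metis fun_upd_triv)
    thus ?thesis using True by (auto simp: partial_def mult_var_def algebra_simps)
  qed (auto simp: partial_def mult_var_def fun_upd_twist)
qed

lemma mult_var_partial: "mult_var i (partial i p) \<alpha> = real (\<alpha> i) * p \<alpha>"
  by (auto simp: mult_var_def partial_def)

lemma mult_var_sum: "mult_var i (\<lambda>\<alpha>. \<Sum>k\<in>A. f k * p k \<alpha>) \<alpha> = (\<Sum>k\<in>A. f k * mult_var i (p k) \<alpha>)"
  by (simp add: mult_var_def)

lemma partial_sum: "partial i (\<lambda>\<alpha>. \<Sum>k\<in>A. f k * p k \<alpha>) \<alpha> = (\<Sum>k\<in>A. f k * partial i (p k) \<alpha>)"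
  by (simp add: partial_def sum_distrib_left mult_ac)

lemma partial_combine: "partial i (\<lambda>\<alpha>. a * p \<alpha> + b * q \<alpha>) = (\<lambda>\<alpha>. a * partial i p \<alpha> + b * partial i q \<alpha>)"
  by (auto simp: partial_def algebra_simps)

lemma mult_var_combine: "mult_var i (\<lambda>\<alpha>. a * p \<alpha> + b * q \<alpha>) = (\<lambda>\<alpha>. a * mult_var i p \<alpha> + b * mult_var i q \<alpha>)"
  by (auto simp: mult_var_def algebra_simps)

lemma dir_deriv_combine: "dir_deriv m x (\<lambda>\<alpha>. a * p \<alpha> + b * q \<alpha>) = (\<lambda>\<alpha>. a * dir_deriv m x p \<alpha> + b * dir_deriv m x q \<alpha>)"
  by (auto simp: dir_deriv_def partial_combine sum.distrib sum_distrib_left algebra_simps)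

lemma laplacian_combine: "laplacian m (\<lambda>\<alpha>. a * p \<alpha> + b * q \<alpha>) = (\<lambda>\<alpha>. a * laplacian m p \<alpha> + b * laplacian m q \<alpha>)"
  by (auto simp: laplacian_def partial_combine sum.distrib sum_distrib_left algebra_simps)

lemma mult_linear_combine: "mult_linear m x (\<lambda>\<alpha>. a * p \<alpha> + b * q \<alpha>) = (\<lambda>\<alpha>. a * mult_linear m x p \<alpha> + b * mult_linear m x q \<alpha>)"
  by (auto simp: mult_linear_def mult_var_combine sum.distrib sum_distrib_left algebra_simps)

lemma partial_mult_linear:
  assumes "i \<le> m"
  shows "partial i (mult_linear m x p) = (\<lambda>\<alpha>. mult_linear m x (partial i p) \<alpha> + x i * p \<alpha>)"
proof
  fix \<alpha>
  have "partial i (mult_linear m x p) \<alpha> = (\<Sum>k\<le>m. x k * mult_var k (partial i p) \<alpha> + (if i = k then x k * p \<alpha> else 0))"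
    by (simp add: mult_linear_def[abs_def] partial_sum partial_mult_var distrib_left if_distrib cong: if_cong)
  thus "partial i (mult_linear m x p) \<alpha> = mult_linear m x (partial i p) \<alpha> + x i * p \<alpha>"
    using assms by (simp add: sum.distrib mult_linear_def)
qed

lemma partial_mult_norm2:
  assumes "i \<le> m"
  shows "partial i (mult_norm2 m p) = (\<lambda>\<alpha>. mult_norm2 m (partial i p) \<alpha> + 2 * mult_var i p \<alpha>)"
proof
  fix \<alpha>
  have "partial i (mult_norm2 m p) \<alpha> = (\<Sum>k\<le>m. partial i (mult_var k (mult_var k p)) \<alpha>)"
    using partial_sum[of i "\<lambda>_. 1" "\<lambda>k. mult_var k (mult_var k p)" "{..m}" \<alpha>]
    by (simp add: mult_norm2_def[abs_def])
  also have "\<dots> = (\<Sum>k\<le>m. mult_var k (mult_var k (partial i p)) \<alpha> + (if i = k then 2 * mult_var k p \<alpha> else 0))"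
  proof (rule sum.cong)
    fix k
    have "mult_var k (\<lambda>\<alpha>. mult_var k (partial i p) \<alpha> + (if i = k then p \<alpha> else 0)) \<alpha> =
          mult_var k (mult_var k (partial i p)) \<alpha> + (if i = k then mult_var k p \<alpha> else 0)"
      by (simp add: mult_var_def)
    thus "partial i (mult_var k (mult_var k p)) \<alpha> =
        mult_var k (mult_var k (partial i p)) \<alpha> + (if i = k then 2 * mult_var k p \<alpha> else 0)"
      by (simp add: partial_mult_var)
  qed simp
  finally show "partial i (mult_norm2 m p) \<alpha> = mult_norm2 m (partial i p) \<alpha> + 2 * mult_var i p \<alpha>"
    using assms by (simp add: sum.distrib mult_norm2_def)
qed

lemma dir_deriv_mult_linear:
  "dir_deriv m x (mult_linear m x p) \<alpha> = mult_linear m x (dir_deriv m x p) \<alpha> + (\<Sum>i\<le>m. x i ^ 2) * p \<alpha>"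
proof -
  have "dir_deriv m x (mult_linear m x p) \<alpha> = (\<Sum>i\<le>m. x i * mult_linear m x (partial i p) \<alpha>) + (\<Sum>i\<le>m. x i ^ 2) * p \<alpha>"
    by (simp add: dir_deriv_def partial_mult_linear distrib_left sum.distrib sum_distrib_right power2_eq_square mult.assoc)
  also have "(\<Sum>i\<le>m. x i * mult_linear m x (partial i p) \<alpha>) = mult_linear m x (dir_deriv m x p) \<alpha>"
    unfolding mult_linear_def dir_deriv_def[abs_def] mult_var_sum sum_distrib_left
    by (subst sum.swap) (simp add: mult_ac)
  finally show ?thesis .
qed

lemma dir_deriv_mult_norm2:
  "dir_deriv m x (mult_norm2 m p) \<alpha> = mult_norm2 m (dir_deriv m x p) \<alpha> + 2 * mult_linear m x p \<alpha>"
proof -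
  have "dir_deriv m x (mult_norm2 m p) \<alpha> = (\<Sum>i\<le>m. x i * mult_norm2 m (partial i p) \<alpha>) + 2 * mult_linear m x p \<alpha>"
    by (simp add: dir_deriv_def mult_linear_def partial_mult_norm2 distrib_left sum.distrib sum_distrib_left mult_ac)
  also have "(\<Sum>i\<le>m. x i * mult_norm2 m (partial i p) \<alpha>) = mult_norm2 m (dir_deriv m x p) \<alpha>"
    unfolding mult_norm2_def dir_deriv_def[abs_def] mult_var_sum[abs_def] sum_distrib_left
    by (subst sum.swap) simp
  finally show ?thesis .
qed

lemma laplacian_mult_linear:
  "laplacian m (mult_linear m x p) \<alpha> = mult_linear m x (laplacian m p) \<alpha> + 2 * dir_deriv m x p \<alpha>"
proof -
  have pa: "partial i (\<lambda>\<alpha>. a \<alpha> + x i * c \<alpha>) = (\<lambda>\<alpha>. partial i a \<alpha> + x i * partial i c \<alpha>)" for i a c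
    using partial_combine[of i 1 a "x i" c] by simp
  have "laplacian m (mult_linear m x p) \<alpha> =
      (\<Sum>i\<le>m. mult_linear m x (partial i (partial i p)) \<alpha> + 2 * (x i * partial i p \<alpha>))"
    unfolding laplacian_def by (intro sum.cong) (auto simp: partial_mult_linear pa)
  also have "\<dots> = (\<Sum>i\<le>m. mult_linear m x (partial i (partial i p)) \<alpha>) + 2 * dir_deriv m x p \<alpha>"
    by (simp add: sum.distrib dir_deriv_def sum_distrib_left)
  also have "(\<Sum>i\<le>m. mult_linear m x (partial i (partial i p)) \<alpha>) = mult_linear m x (laplacian m p) \<alpha>"
    using mult_var_sum[of _ "\<lambda>_. 1" "\<lambda>i. partial i (partial i p)" "{..m}" \<alpha>]
    unfolding mult_linear_def laplacian_def[abs_def]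
    by (subst sum.swap) (simp add: sum_distrib_left)
  finally show ?thesis .
qed

text \<open>The commutator of the Laplacian with |y|^2 in m + 1 variables is 4 E + 2 (m + 1), where
  the Euler operator E multiplies the coefficient at an exponent vector by its total degree.\<close>

lemma laplacian_mult_norm2:
  "laplacian m (mult_norm2 m p) \<alpha> = mult_norm2 m (laplacian m p) \<alpha> +
     (4 * real (\<Sum>i\<le>m. \<alpha> i) + 2 * (real m + 1)) * p \<alpha>"
proof -
  have "laplacian m (mult_norm2 m p) \<alpha> =
      (\<Sum>i\<le>m. mult_norm2 m (partial i (partial i p)) \<alpha> + (4 * real (\<alpha> i) + 2) * p \<alpha>)"
    unfolding laplacian_def
  proof (intro sum.cong)
    fix i assume i: "i \<in> {..m}"
    have "partial i (partial i (mult_norm2 m p)) \<alpha> = partial i (\<lambda>\<alpha>. 1 * mult_norm2 m (partial i p) \<alpha> + 2 * mult_var i p \<alpha>) \<alpha>"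
      using i by (simp add: partial_mult_norm2)
    also have "\<dots> = mult_norm2 m (partial i (partial i p)) \<alpha> + 4 * mult_var i (partial i p) \<alpha> + 2 * p \<alpha>"
      using i by (simp only: partial_combine) (simp add: partial_mult_norm2 partial_mult_var)
    finally show "partial i (partial i (mult_norm2 m p)) \<alpha> = mult_norm2 m (partial i (partial i p)) \<alpha> + (4 * real (\<alpha> i) + 2) * p \<alpha>"
      by (simp add: mult_var_partial algebra_simps)
  qed simp
  also have "\<dots> = (\<Sum>i\<le>m. mult_norm2 m (partial i (partial i p)) \<alpha>) + (4 * real (\<Sum>i\<le>m. \<alpha> i) + 2 * (real m + 1)) * p \<alpha>"
    by (simp add: sum.distrib sum_distrib_left sum_distrib_right algebra_simps)
  also have "(\<Sum>i\<le>m. mult_norm2 m (partial i (partial i p)) \<alpha>) = mult_norm2 m (laplacian m p) \<alpha>"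
    using mult_var_sum[of _ "\<lambda>_. 1" _ "{..m}", abs_def]
    unfolding mult_norm2_def laplacian_def[abs_def]
    by (subst sum.swap) simp
  finally show ?thesis .
qed

subsection \<open>Zonal harmonics\<close>

text \<open>For \<open>|x| = 1\<close> this is the solid zonal harmonic \<open>|y|\<^sup>n P\<^sub>n(\<langle>x,y\<rangle>/|y|)\<close>, defined by the homogenised
  recurrence of \<^const>\<open>norm_gegenbauer\<close> with parameter \<open>(m - 1)/2\<close>.\<close>

fun zonal :: "nat \<Rightarrow> (nat \<Rightarrow> real) \<Rightarrow> nat \<Rightarrow> (nat \<Rightarrow> nat) \<Rightarrow> real" where
  "zonal m x 0 = (\<lambda>\<alpha>. if (\<Sum>i\<le>m. \<alpha> i) = 0 then 1 else 0)"
| "zonal m x (Suc 0) = mult_linear m x (zonal m x 0)"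
| "zonal m x (Suc (Suc n)) =
     (\<lambda>\<alpha>. (2 * real n + 1 + real m) / (real n + real m) * mult_linear m x (zonal m x (Suc n)) \<alpha> +
           (- (real n + 1) / (real n + real m)) * mult_norm2 m (zonal m x n) \<alpha>)"

declare zonal.simps(3) [simp del]

lemma multiindices_0: "multiindices m 0 = {\<lambda>_. 0}"
proof
  show "multiindices m 0 \<subseteq> {\<lambda>_. 0}"
  proof
    fix \<alpha> assume a: "\<alpha> \<in> multiindices m 0"
    have "\<alpha> i = 0" for i
      using a by (cases "i \<le> m") (auto simp: multiindices_def)
    thus "\<alpha> \<in> {\<lambda>_. 0}" by auto
  qed
qed (auto simp: multiindices_def)

lemma mult_var_homogeneous:
  assumes "\<And>\<alpha>. (\<Sum>i\<le>m. \<alpha> i) \<noteq> n \<Longrightarrow> p \<alpha> = 0" "i \<le> m" "(\<Sum>i\<le>m. \<alpha> i) \<noteq> Suc n"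
  shows "mult_var i p \<alpha> = 0"
  using assms sum_fun_upd[OF assms(2), of \<alpha> "\<alpha> i - 1"]
  by (auto simp: mult_var_def intro!: assms(1))

text \<open>Lets the total degree produced by \<open>laplacian_mult_norm2\<close> be replaced by
  \<open>n\<close>, although coefficient functions are defined at all exponents.\<close>

lemma zonal_homogeneous: "(\<Sum>i\<le>m. \<alpha> i) \<noteq> n \<Longrightarrow> zonal m x n \<alpha> = 0"
proof (induction n arbitrary: \<alpha> rule: induct_nat_012)
  case 1
  have "mult_var i (zonal m x 0) \<alpha> = 0" if "i \<le> m" for i
    using that 1 by (intro mult_var_homogeneous[where n = 0 and m = m]) auto
  then show ?case by (simp add: mult_linear_def)
next
  case (ge2 n)
  have "mult_var i (zonal m x (Suc n)) \<alpha> = 0" if "i \<le> m" for i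
    by (rule mult_var_homogeneous[OF ge2.IH(2) that]) (use ge2.prems in auto)
  moreover have "mult_var i (mult_var i (zonal m x n)) \<alpha> = 0" if "i \<le> m" for i
    by (rule mult_var_homogeneous[OF mult_var_homogeneous[OF ge2.IH(1) that] that]) (use ge2.prems in auto)
  ultimately show ?case
    by (simp add: zonal.simps mult_linear_def mult_norm2_def)
qed simp

lemma zonal_eval:
  assumes "m \<ge> 1" "(\<Sum>i\<le>m. y i ^ 2) = 1"
  shows "poly_eval m n (zonal m x n) y = norm_gegenbauer ((real m - 1) / 2) n (\<Sum>i\<le>m. x i * y i)"
proof (induction n rule: induct_nat_012)
  case 0
  show ?case
    by (simp add: poly_eval_def multiindices_0 monomial_def)
next
  case 1
  show ?case
    by (simp add: poly_eval_mult_linear) (simp add: poly_eval_def multiindices_0 monomial_def)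
next
  case (ge2 n)
  have c: "poly_eval m k (\<lambda>\<alpha>. a * p \<alpha> + b * q \<alpha>) y = a * poly_eval m k p y + b * poly_eval m k q y" for k a b p q
    by (simp add: poly_eval_eq_fischer fischer_combine_left)
  show ?case
    unfolding zonal.simps norm_gegenbauer.simps c poly_eval_mult_linear poly_eval_mult_norm2 ge2 assms(2)
    using assms(1) by (simp add: divide_simps) (simp add: algebra_simps)
qed

lemma zonal_rec':
  assumes "m \<ge> 1"
  shows "(real n + real m - 1) * zonal m x (Suc n) \<alpha> =
    (2 * real n + real m - 1) * mult_linear m x (zonal m x n) \<alpha> - real n * mult_norm2 m (zonal m x (n - 1)) \<alpha>"
proof (cases n)
  case (Suc k)
  have "(real k + real m) * zonal m x (Suc (Suc k)) \<alpha> =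
    (2 * real k + 1 + real m) * mult_linear m x (zonal m x (Suc k)) \<alpha> - (real k + 1) * mult_norm2 m (zonal m x k) \<alpha>"
    using assms by (simp add: zonal.simps divide_simps) (simp add: algebra_simps)
  then show ?thesis using Suc by (simp add: algebra_simps)
qed simp

lemma partial_zonal_0: "i \<le> m \<Longrightarrow> partial i (zonal m x 0) = (\<lambda>_. 0)"
  using sum_fun_upd[of i m] by (force simp: partial_def)

lemma mult_linear_scale: "mult_linear m x (\<lambda>\<alpha>. a * p \<alpha>) \<alpha> = a * mult_linear m x p \<alpha>"
  using mult_linear_combine[of m x a p 0 p] by (simp add: fun_eq_iff)

lemma mult_norm2_scale: "mult_norm2 m (\<lambda>\<alpha>. a * p \<alpha>) \<alpha> = a * mult_norm2 m p \<alpha>"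
proof -
  have "mult_var i (\<lambda>\<alpha>. a * q \<alpha>) = (\<lambda>\<alpha>. a * mult_var i q \<alpha>)" for i q
    by (auto simp: mult_var_def)
  thus ?thesis by (simp add: mult_norm2_def sum_distrib_left)
qed

lemma mult_linear_zero: "mult_linear m x (\<lambda>_. 0) = (\<lambda>_. 0)"
  by (simp add: mult_linear_def mult_var_def fun_eq_iff)

lemma mult_norm2_zero: "mult_norm2 m (\<lambda>_. 0) = (\<lambda>_. 0)"
  using mult_norm2_scale[of m 0] by (simp add: fun_eq_iff)

text \<open>Differentiating the recurrence, the commutators leave terms of one degree less, which
  the recurrence one step earlier collapses. The result evaluates the derivative term in
  \<open>laplacian_mult_linear\<close>.\<close>

lemma dir_deriv_zonal:
  assumes "m \<ge> 1" "(\<Sum>i\<le>m. x i ^ 2) = 1"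
  shows "dir_deriv m x (zonal m x n) = (\<lambda>\<alpha>. real n * zonal m x (n - 1) \<alpha>)"
proof (induction n rule: induct_nat_012)
  case 0
  show ?case
    by (simp add: dir_deriv_def[abs_def] partial_zonal_0 del: zonal.simps)
next
  case 1
  have "dir_deriv m x (zonal m x 0) = (\<lambda>_. 0)"
    by (simp add: dir_deriv_def[abs_def] partial_zonal_0 del: zonal.simps(1))
  hence "dir_deriv m x (mult_linear m x (zonal m x 0)) = zonal m x 0"
    by (intro ext) (simp add: dir_deriv_mult_linear mult_linear_zero assms del: zonal.simps)
  thus ?case by (simp del: zonal.simps(1))
next
  case (ge2 n)
  show ?case
  proof
    fix \<alpha>
    define c where "c = real n + real m"
    have c: "c > 0" using assms by (simp add: c_def)
    define Z where "Z = zonal m x"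
    define L where "L = mult_linear m x (Z n) \<alpha>"
    define Q where "Q = mult_norm2 m (Z (n - 1)) \<alpha>"
    have eq: "dir_deriv m x (Z (Suc (Suc n))) \<alpha> = (2 * real n + 1 + real m) / c * ((real n + 1) * L + Z (Suc n) \<alpha>) +
        (- (real n + 1) / c) * (real n * Q + 2 * L)"
      unfolding Z_def zonal.simps(3) dir_deriv_combine dir_deriv_mult_linear dir_deriv_mult_norm2 assms ge2
        mult_linear_scale mult_norm2_scale
      by (simp add: c_def L_def Q_def Z_def del: zonal.simps(1))
    have *: "c * (a / c * u + (- b / c) * v) = a * u - b * v" for a b u v
      using c by (simp add: right_diff_distrib)
    have "c * dir_deriv m x (Z (Suc (Suc n))) \<alpha> = (2 * real n + 1 + real m) * ((real n + 1) * L + Z (Suc n) \<alpha>) -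
        (real n + 1) * (real n * Q + 2 * L)"
      unfolding eq by (rule *)
    also have "\<dots> = c * (real (Suc (Suc n)) * Z (Suc n) \<alpha>)"
      using zonal_rec'[OF assms(1), of n x \<alpha>] unfolding c_def L_def[symmetric] Q_def[symmetric] Z_def[symmetric]
      by simp algebra
    finally show "dir_deriv m x (zonal m x (Suc (Suc n))) \<alpha> = real (Suc (Suc n)) * zonal m x (Suc (Suc n) - 1) \<alpha>"
      using c by (simp add: Z_def)
  qed
qed

text \<open>In the recurrence the linear factor contributes 2 (2n + 1 + m) (n + 1) Z_n and the
  squared norm -(n + 1) (4n + 2 (m + 1)) Z_n, over the same denominator; these cancel
  exactly.\<close>

lemma laplacian_zonal:
  assumes "m \<ge> 1" "(\<Sum>i\<le>m. x i ^ 2) = 1"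
  shows "laplacian m (zonal m x n) = (\<lambda>_. 0)"
proof (induction n rule: induct_nat_012)
  have p0: "partial i (\<lambda>_. 0) = (\<lambda>_. 0)" for i
    by (simp add: partial_def fun_eq_iff)
  case 0
  show l: ?case
    by (simp add: laplacian_def[abs_def] partial_zonal_0 p0 del: zonal.simps)
  case 1
  show ?case
    unfolding zonal.simps(2) fun_eq_iff laplacian_mult_linear l mult_linear_zero dir_deriv_zonal[OF assms] by simp
  case (ge2 n)
  show ?case
  proof
    fix \<alpha>
    have h: "real (\<Sum>i\<le>m. \<alpha> i) * zonal m x n \<alpha> = real n * zonal m x n \<alpha>"
      using zonal_homogeneous[of \<alpha> m n x] by (cases "(\<Sum>i\<le>m. \<alpha> i) = n") simp_all
    have "(4 * real (\<Sum>i\<le>m. \<alpha> i) + 2 * (real m + 1)) * zonal m x n \<alpha> =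
          4 * (real (\<Sum>i\<le>m. \<alpha> i) * zonal m x n \<alpha>) + 2 * (real m + 1) * zonal m x n \<alpha>"
      by (simp only: distrib_right mult.assoc)
    also have "\<dots> = (4 * real n + 2 * (real m + 1)) * zonal m x n \<alpha>"
      unfolding h by (simp only: distrib_right mult.assoc)
    finally have h': "(4 * real (\<Sum>i\<le>m. \<alpha> i) + 2 * (real m + 1)) * zonal m x n \<alpha> =
      (4 * real n + 2 * (real m + 1)) * zonal m x n \<alpha>" .
    show "laplacian m (zonal m x (Suc (Suc n))) \<alpha> = 0"
      unfolding zonal.simps(3) laplacian_combine laplacian_mult_linear laplacian_mult_norm2 ge2 mult_linear_zero mult_norm2_zero
        dir_deriv_zonal[OF assms] h'
      using assms(1) by (simp add: divide_simps) (simp add: algebra_simps)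
  qed
qed

section \<open>The reproducing property\<close>

lemma laplacian_dir_deriv: "laplacian m (dir_deriv m x p) \<alpha> = dir_deriv m x (laplacian m p) \<alpha>"
proof -
  have c: "partial i (partial j p) = partial j (partial i p)" for i j p
    by (auto simp: partial_def fun_eq_iff fun_upd_twist)
  have "laplacian m (dir_deriv m x p) \<alpha> = (\<Sum>i\<le>m. \<Sum>j\<le>m. x j * partial i (partial i (partial j p)) \<alpha>)"
    unfolding laplacian_def dir_deriv_def[abs_def] partial_sum[abs_def] ..
  also have "\<dots> = (\<Sum>j\<le>m. \<Sum>i\<le>m. x j * partial j (partial i (partial i p)) \<alpha>)"
    by (subst sum.swap) (simp add: c)
  also have "\<dots> = dir_deriv m x (laplacian m p) \<alpha>"
    using partial_sum[of _ "\<lambda>_. 1" _ "{..m}", abs_def]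
    unfolding laplacian_def[abs_def] dir_deriv_def by (simp add: sum_distrib_left)
  finally show ?thesis .
qed

text \<open>Euler's identity by adjointness: multiplying the exponential of
  \<open>poly_eval_eq_fischer\<close> by <y, .> multiplies its coefficient at an exponent vector by
  the total degree.\<close>

lemma euler_homogeneous: "poly_eval m n (dir_deriv m y p) y = real (Suc n) * poly_eval m (Suc n) p y"
proof -
  define e where "e = (\<lambda>\<alpha>. monomial m y \<alpha> / mfact m \<alpha>)"
  have "y i * mult_var i e \<alpha> = real (\<alpha> i) * e \<alpha>" if "i \<le> m" for i \<alpha>
  proof (cases "\<alpha> i")
    case (Suc k)
    define \<beta> where "\<beta> = \<alpha>(i := k)"
    have \<alpha>: "\<alpha> = \<beta>(i := Suc (\<beta> i))" using Suc by (auto simp: \<beta>_def fun_eq_iff)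
    show ?thesis
      using mfact_pos[of m \<beta>] unfolding \<alpha>
      by (simp add: mult_var_def e_def monomial_Suc[OF that] mfact_Suc[OF that])
  qed (simp add: mult_var_def)
  hence "mult_linear m y e \<alpha> = real (\<Sum>i\<le>m. \<alpha> i) * e \<alpha>" for \<alpha>
    by (simp add: mult_linear_def sum_distrib_right)
  hence "fischer m (Suc n) (mult_linear m y e) p = fischer m (Suc n) (\<lambda>\<alpha>. real (Suc n) * e \<alpha>) p"
    by (intro fischer_cong) (auto simp: multiindices_def simp del: of_nat_sum)
  thus ?thesis
    unfolding poly_eval_eq_fischer fischer_scale_left e_def[symmetric]
    by (simp add: fischer_mult_linear fischer_commute[of m _ _ e])
qed

text \<open>Zonal harmonics reproduce harmonic polynomials under the Fischer pairing, so the kernels are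
  Gram matrices.\<close>

lemma harmonic_reproducing:
  assumes "m \<ge> 1"
  shows "\<exists>h>0. \<forall>p y. laplacian m p = (\<lambda>_. 0) \<longrightarrow> fischer m n p (zonal m y n) = h * poly_eval m n p y"
proof (induction n rule: induct_nat_012)
  case 0
  show ?case
    by (intro exI[of _ 1]) (simp add: fischer_def poly_eval_def multiindices_0 mfact_def monomial_def)
next
  case 1
  have "fischer m (Suc 0) p (zonal m y (Suc 0)) = 1 * poly_eval m (Suc 0) p y" for p y
    using euler_homogeneous[of m 0 y p]
    unfolding zonal.simps(2) fischer_commute[of _ _ p] fischer_mult_linear
    by (simp add: fischer_def poly_eval_def multiindices_0 mfact_def monomial_def)
  thus ?case using zero_less_one by blast
next
  case (ge2 n)
  then obtain h where h: "h > 0"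
    "\<And>p y. laplacian m p = (\<lambda>_. 0) \<Longrightarrow> fischer m (Suc n) p (zonal m y (Suc n)) = h * poly_eval m (Suc n) p y"
    by blast
  define h' where "h' = (2 * real n + 1 + real m) / (real n + real m) * h * real (Suc (Suc n))"
  have "fischer m (Suc (Suc n)) p (zonal m y (Suc (Suc n))) = h' * poly_eval m (Suc (Suc n)) p y"
    if p: "laplacian m p = (\<lambda>_. 0)" for p y
  proof -
    have "laplacian m (dir_deriv m y p) = (\<lambda>_. 0)"
      by (simp add: fun_eq_iff laplacian_dir_deriv p) (simp add: dir_deriv_def partial_def)
    note h = h(2)[OF this]
    \<comment> \<open>In the recurrence for the zonal harmonic, adjointness sends the squared norm
      to the Laplacian of \<open>p\<close>, which vanishes, and the linear factor to the derivative
      of \<open>p\<close> along \<open>y\<close>, again harmonic and of one degree less. Euler's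
      identity supplies the factor n + 2 in \<open>h'\<close>.\<close>
    have "fischer m (Suc (Suc n)) p (zonal m y (Suc (Suc n))) =
       (2 * real n + 1 + real m) / (real n + real m) * fischer m (Suc n) (zonal m y (Suc n)) (dir_deriv m y p) +
       (- (real n + 1) / (real n + real m)) * fischer m n (zonal m y n) (laplacian m p)"
      unfolding zonal.simps(3) fischer_combine_right fischer_commute[of _ _ p] fischer_mult_linear fischer_mult_norm2 ..
    also have "fischer m n (zonal m y n) (laplacian m p) = 0"
      by (simp add: p fischer_def)
    also have "fischer m (Suc n) (zonal m y (Suc n)) (dir_deriv m y p) = h * (real (Suc (Suc n)) * poly_eval m (Suc (Suc n)) p y)"
      by (subst fischer_commute) (simp only: h euler_homogeneous)
    finally show ?thesis by (simp add: h'_def)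
  qed
  moreover have "h' > 0" using h(1) assms by (simp add: h'_def)
  ultimately show ?case by blast
qed

lemma poly_eval_sum: "poly_eval m n (\<lambda>\<alpha>. \<Sum>i\<in>A. f i * p i \<alpha>) y = (\<Sum>i\<in>A. f i * poly_eval m n (p i) y)"
  by (simp add: poly_eval_eq_fischer fischer_sum_left)

lemma laplacian_sum: "laplacian m (\<lambda>\<alpha>. \<Sum>i\<in>A. f i * p i \<alpha>) \<alpha> = (\<Sum>i\<in>A. f i * laplacian m (p i) \<alpha>)"
  unfolding laplacian_def partial_sum[abs_def] sum_distrib_left by (rule sum.swap)

section \<open>Positive semidefiniteness of the kernels and the bound by 1\<close>

lemma norm_gegenbauer_gram_nonneg:
  fixes x :: "'a \<Rightarrow> nat \<Rightarrow> real"
  assumes "m \<ge> 1" "\<And>a. a \<in> A \<Longrightarrow> (\<Sum>i\<le>m. x a i ^ 2) = 1"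
  shows "(\<Sum>a\<in>A. \<Sum>b\<in>A. c a * c b * norm_gegenbauer ((real m - 1) / 2) n (\<Sum>i\<le>m. x a i * x b i)) \<ge> 0"
proof -
  obtain h where h: "h > 0"
    "\<And>p y. laplacian m p = (\<lambda>_. 0) \<Longrightarrow> fischer m n p (zonal m y n) = h * poly_eval m n p y"
    using harmonic_reproducing[OF assms(1)] by blast
  define p where "p = (\<lambda>\<alpha>. \<Sum>a\<in>A. c a * zonal m (x a) n \<alpha>)"
  have "laplacian m p = (\<lambda>_. 0)"
    by (auto simp: p_def fun_eq_iff laplacian_sum laplacian_zonal[OF assms] intro!: sum.neutral)
  note h2 = h(2)[OF this]
  have "fischer m n p p = (\<Sum>b\<in>A. c b * fischer m n p (zonal m (x b) n))"
    by (subst (2) p_def) (simp add: fischer_sum_right)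
  also have "\<dots> = h * (\<Sum>b\<in>A. \<Sum>a\<in>A. c a * c b * norm_gegenbauer ((real m - 1) / 2) n (\<Sum>i\<le>m. x a i * x b i))"
    unfolding h2
    by (auto simp: p_def poly_eval_sum zonal_eval[OF assms(1)] assms sum_distrib_left mult_ac intro!: sum.cong)
  finally have "h * (\<Sum>b\<in>A. \<Sum>a\<in>A. c a * c b * norm_gegenbauer ((real m - 1) / 2) n (\<Sum>i\<le>m. x a i * x b i)) \<ge> 0"
    using fischer_self_nonneg[of m n p] by simp
  thus ?thesis using h(1) by (subst sum.swap) (simp add: zero_le_mult_iff)
qed

text \<open>Two unit vectors with inner product \<open>t\<close>, with weights (1, 1) and (1, -1),
  give 2 + 2 P_n(t) >= 0 and 2 - 2 P_n(t) >= 0. Two coordinates suffice for such vectors.\<close>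

lemma abs_norm_gegenbauer_le_1:
  assumes "m \<ge> 1" "\<bar>t\<bar> \<le> 1"
  shows "\<bar>norm_gegenbauer ((real m - 1) / 2) n t\<bar> \<le> 1"
proof -
  have t: "t\<^sup>2 \<le> 1" using assms(2) by (simp add: abs_square_le_1)
  define x :: "bool \<Rightarrow> nat \<Rightarrow> real" where
    "x = (\<lambda>a i. if i = 0 then (if a then 1 else t) else if i = 1 \<and> \<not> a then sqrt (1 - t\<^sup>2) else 0)"
  obtain k where m: "m = Suc k" using assms(1) by (cases m) auto
  have s: "sum f {..m} = f 0 + f 1" if "\<And>i. i \<ge> 2 \<Longrightarrow> f i = 0" for f :: "nat \<Rightarrow> real"
  proof -
    have "sum f {..m} = sum f {0, 1}"
      using assms(1) by (intro sum.mono_neutral_right) (auto intro!: that)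
    thus ?thesis by simp
  qed
  have "(\<Sum>i\<le>m. x a i ^ 2) = 1" for a
    by (subst s) (use t in \<open>auto simp: x_def\<close>)
  note g = norm_gegenbauer_gram_nonneg[OF assms(1), of UNIV x, OF this]
  have ip: "(\<Sum>i\<le>m. x True i * x False i) = t" "(\<Sum>i\<le>m. x False i * x True i) = t"
    "(\<Sum>i\<le>m. x True i * x True i) = 1" "(\<Sum>i\<le>m. x False i * x False i) = 1"
    using t by (subst s; auto simp: x_def simp flip: power2_eq_square)+
  have one: "norm_gegenbauer ((real m - 1) / 2) n 1 = 1"
    using assms(1) by (intro norm_gegenbauer_1) simp
  show ?thesis
    using g[of "\<lambda>a. 1" n] g[of "\<lambda>a. if a then 1 else - 1" n]
    by (simp add: UNIV_bool ip one abs_le_iff)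
qed

subsection \<open>The maximum principle\<close>

lemma poly_eval_has_derivative:
  assumes "i \<le> m"
  shows "((\<lambda>s. poly_eval m (Suc n) p (y(i := s))) has_real_derivative poly_eval m n (partial i p) (y(i := s))) (at s)"
proof -
  define R where "R = (\<lambda>\<alpha>. \<Prod>k\<in>{..m} - {i}. y k ^ \<alpha> k)"
  have mono: "monomial m (y(i := s)) \<alpha> = s ^ \<alpha> i * R \<alpha>" for s \<alpha>
    unfolding monomial_def R_def using assms
    by (subst prod.remove[of _ i]) (auto intro!: prod.cong)
  have R: "R (\<alpha>(i := v)) = R \<alpha>" for \<alpha> v
    by (auto simp: R_def intro!: prod.cong)
  have "((\<lambda>s. \<Sum>\<alpha>\<in>multiindices m (Suc n). p \<alpha> * (s ^ \<alpha> i * R \<alpha>)) has_real_derivative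
      (\<Sum>\<alpha>\<in>multiindices m (Suc n). p \<alpha> * (real (\<alpha> i) * s ^ (\<alpha> i - 1) * R \<alpha>))) (at s)"
    by (auto intro!: derivative_eq_intros sum.cong simp: mult_ac)
  also have "(\<Sum>\<alpha>\<in>multiindices m (Suc n). p \<alpha> * (real (\<alpha> i) * s ^ (\<alpha> i - 1) * R \<alpha>)) =
    (\<Sum>\<alpha>\<in>multiindices m (Suc n). if \<alpha> i = 0 then 0 else p \<alpha> * (real (\<alpha> i) * s ^ (\<alpha> i - 1) * R \<alpha>))"
    by (intro sum.cong) auto
  also have "\<dots> = poly_eval m n (partial i p) (y(i := s))"
    by (subst sum_multiindices_raise[OF assms]) (simp add: poly_eval_def mono R partial_def mult_ac)
  finally show ?thesis by (simp add: poly_eval_def mono)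
qed

text \<open>The first derivative vanishes at the minimum; a negative second derivative would make it
  negative just to the right, and the mean value theorem would push \<open>f\<close> below its
  minimum.\<close>

lemma second_derivative_at_min_nonneg:
  fixes f :: "real \<Rightarrow> real"
  assumes "\<And>s. (f has_real_derivative f' s) (at s)" "(f' has_real_derivative f'') (at s0)"
    and "e > 0" "\<And>s. \<bar>s - s0\<bar> < e \<Longrightarrow> f s0 \<le> f s"
  shows "f'' \<ge> 0"
proof (rule ccontr)
  assume "\<not> f'' \<ge> 0"
  hence neg: "f'' < 0" by simp
  have "f' s0 = 0"
    by (rule DERIV_local_min[OF assms(1) assms(3)]) (use assms(4) in \<open>auto simp: abs_minus_commute\<close>)
  with DERIV_neg_dec_right[OF assms(2) neg] obtain d where
    d: "d > 0" "\<And>h. 0 < h \<Longrightarrow> h < d \<Longrightarrow> f' (s0 + h) < 0" by auto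
  define h where "h = min d e / 2"
  have h: "h > 0" "h < d" "h < e" using d(1) assms(3) by (auto simp: h_def)
  obtain z where z: "s0 < z" "z < s0 + h" "f (s0 + h) - f s0 = (s0 + h - s0) * f' z"
    using MVT2[of s0 "s0 + h" f f'] h(1) assms(1) by auto
  have "f' z < 0" using d(2)[of "z - s0"] z h by simp
  hence "f (s0 + h) < f s0" using z(3) h(1) by (simp add: mult_less_0_iff algebra_simps)
  with assms(4)[of "s0 + h"] h show False by simp
qed

lemma continuous_on_apply: "continuous_on S (\<lambda>y :: nat \<Rightarrow> real. y i)"
  by (rule continuous_on_subset[OF continuous_on_product_coordinates subset_UNIV])

lemma continuous_on_poly_eval: "continuous_on S (poly_eval m n p)"
  unfolding poly_eval_def[abs_def] monomial_def
  by (intro continuous_intros continuous_on_apply)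

text \<open>Points are functions on all of \<open>nat\<close>: the ball is a closed subset of a
  product of intervals for the first m + 1 coordinates and of singletons beyond, which is compact by
  Tychonoff.\<close>

lemma compact_unit_ball_fun: "compact {y :: nat \<Rightarrow> real. (\<forall>i>m. y i = 0) \<and> (\<Sum>i\<le>m. y i ^ 2) \<le> 1}"
proof -
  define B where "B = PiE UNIV (\<lambda>i. if i \<le> m then {-1..1::real} else {0})"
  have "compactin (product_topology (\<lambda>_. euclidean) UNIV) B"
    unfolding B_def by (subst compactin_PiE) auto
  hence "compact B" by (simp add: euclidean_product_topology)
  moreover have "closed {y :: nat \<Rightarrow> real. (\<Sum>i\<le>m. y i ^ 2) \<le> 1}"
    by (intro closed_Collect_le continuous_intros continuous_on_apply)
  ultimately have "compact (B \<inter> {y. (\<Sum>i\<le>m. y i ^ 2) \<le> 1})" by (rule compact_Int_closed)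
  also have "B \<inter> {y. (\<Sum>i\<le>m. y i ^ 2) \<le> 1} = {y. (\<forall>i>m. y i = 0) \<and> (\<Sum>i\<le>m. y i ^ 2) \<le> 1}"
  proof -
    have "\<bar>y i\<bar> \<le> 1" if "(\<Sum>i\<le>m. y i ^ 2) \<le> 1" "i \<le> m" for y :: "nat \<Rightarrow> real" and i
      using member_le_sum[of i "{..m}" "\<lambda>i. y i ^ 2"] that by (simp add: abs_square_le_1[symmetric])
    hence "-1 \<le> y i \<and> y i \<le> 1" if "(\<Sum>i\<le>m. y i ^ 2) \<le> 1" "i \<le> m" for y :: "nat \<Rightarrow> real" and i
      using that by (force simp: abs_le_iff)
    thus ?thesis by (auto simp: B_def PiE_iff split: if_splits)
  qed
  finally show ?thesis .
qed

text \<open>Maximum principle: on the ball, subtracting a small multiple of the squared norm from a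
  harmonic polynomial leaves no interior minimum.\<close>

lemma harmonic_nonpos_on_sphere:
  assumes harm: "\<And>n. n \<in> {1..N} \<Longrightarrow> laplacian m (p n) = (\<lambda>_. 0)"
  shows "\<exists>y. (\<forall>i>m. y i = 0) \<and> (\<Sum>i\<le>m. y i ^ 2) = 1 \<and> (\<Sum>n=1..N. poly_eval m n (p n) y) \<le> 0"
proof (rule ccontr)
  assume neg: "\<not> ?thesis"
  define U where "U = (\<lambda>y. \<Sum>n=1..N. poly_eval m n (p n) y)"
  define q where "q = (\<lambda>y :: nat \<Rightarrow> real. \<Sum>i\<le>m. y i ^ 2)"
  define B where "B = {y :: nat \<Rightarrow> real. (\<forall>i>m. y i = 0) \<and> q y \<le> 1}"
  have cB: "compact B" unfolding B_def q_def by (rule compact_unit_ball_fun)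
  have cq: "continuous_on S q" for S
    unfolding q_def by (intro continuous_intros continuous_on_apply)
  have cU: "continuous_on S U" for S
    unfolding U_def by (intro continuous_intros continuous_on_poly_eval)
  have S: "compact {y \<in> B. q y = 1}"
  proof -
    have "{y \<in> B. q y = 1} = B \<inter> {y. q y = 1}" by auto
    thus ?thesis
      using compact_Int_closed[OF cB, of "{y. q y = 1}"] closed_Collect_eq[OF cq, of "\<lambda>_. 1"] by auto
  qed
  have pos: "U y > 0" if "y \<in> B" "q y = 1" for y
    using neg that by (auto simp: U_def B_def q_def not_le)
  have "(\<lambda>i. if i = 0 then 1 else 0) \<in> {y \<in> B. q y = 1}"
    by (auto simp: B_def q_def if_distrib[of "\<lambda>x. x ^ 2"] cong: if_cong)
  then obtain ys where ys: "ys \<in> B" "q ys = 1" "\<And>y. y \<in> B \<Longrightarrow> q y = 1 \<Longrightarrow> U ys \<le> U y"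
    using continuous_attains_inf[OF S _ cU] by auto
  \<comment> \<open>Half the minimum of \<open>U\<close> on the sphere: there \<open>W\<close> is
    then at least \<open>e > 0\<close>, while \<open>W\<close> vanishes at the origin because no
    degree 0 occurs. So the minimum of \<open>W\<close> lies in the open ball.\<close>
  define e where "e = U ys / 2"
  have e: "e > 0" using pos[OF ys(1,2)] by (simp add: e_def)
  have ge: "U y \<ge> 2 * e" if "y \<in> B" "q y = 1" for y
    using ys(3)[OF that] by (simp add: e_def)
  define W where "W = (\<lambda>y. U y - e * q y)"
  have z: "(\<lambda>_. 0) \<in> B" by (simp add: B_def q_def)
  have W0: "W (\<lambda>_. 0) = 0"
  proof -
    have "poly_eval m n (p n) (\<lambda>_. 0) = 0" if "n \<ge> 1" for n
      unfolding poly_eval_def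
    proof (intro sum.neutral ballI)
      fix \<alpha> assume a: "\<alpha> \<in> multiindices m n"
      hence "(\<Sum>i\<le>m. \<alpha> i) \<noteq> 0" using that by (simp add: multiindices_def)
      then obtain i where "i \<le> m" "\<alpha> i \<noteq> 0" by (metis atMost_iff sum.neutral)
      hence "monomial m (\<lambda>_. 0) \<alpha> = 0" by (auto simp: monomial_def intro!: prod_zero bexI[of _ i])
      thus "p n \<alpha> * monomial m (\<lambda>_. 0) \<alpha> = 0" by simp
    qed
    thus ?thesis by (simp add: W_def U_def q_def)
  qed
  have "continuous_on B W" unfolding W_def by (intro continuous_intros cU cq)
  then obtain y0 where y0: "y0 \<in> B" "\<And>y. y \<in> B \<Longrightarrow> W y0 \<le> W y"
    using continuous_attains_inf[OF cB] z by blast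
  have "q y0 \<noteq> 1"
  proof
    assume "q y0 = 1"
    hence "W y0 > 0" using ge[OF y0(1)] e by (simp add: W_def)
    with y0(2)[OF z] W0 show False by simp
  qed
  hence q1: "q y0 < 1" using y0(1) by (auto simp: B_def)
  define P1 where "P1 = (\<lambda>i y. \<Sum>n=1..N. poly_eval m (n - 1) (partial i (p n)) y)"
  \<comment> \<open>Degree 1 is treated apart: its second derivative is 0, whereas the index
    \<open>n - 2\<close> would be truncated.\<close>
  define P2 where "P2 = (\<lambda>i. \<Sum>n=1..N. if n = 1 then 0 else poly_eval m (n - 2) (partial i (partial i (p n))) y0)"
  have "P2 i - 2 * e \<ge> 0" if i: "i \<le> m" for i
  proof -
    have D: "((\<lambda>s. poly_eval m n (p n) (y0(i := s))) has_real_derivative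
        poly_eval m (n - 1) (partial i (p n)) (y0(i := s))) (at s)" if "n \<in> {1..N}" for n s
      using poly_eval_has_derivative[OF i, of "n - 1" "p n" y0 s] that by simp
    have D': "((\<lambda>s. poly_eval m (n - 1) (partial i (p n)) (y0(i := s))) has_real_derivative
        (if n = 1 then 0 else poly_eval m (n - 2) (partial i (partial i (p n))) y0)) (at (y0 i))" if "n \<in> {1..N}" for n
    proof (cases "n = 1")
      case True
      have "poly_eval m 0 q (y0(i := s)) = poly_eval m 0 q y0" for q s
        by (simp add: poly_eval_def multiindices_0 monomial_def)
      thus ?thesis using True by simp
    next
      case False
      then obtain k where "n = Suc (Suc k)" using \<open>n \<in> {1..N}\<close>
        by (metis atLeastAtMost_iff not_one_le_zero old.nat.exhaust One_nat_def)
      thus ?thesis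
        using poly_eval_has_derivative[OF i, of k "partial i (p n)" y0 "y0 i"] by simp
    qed
    have q: "q (y0(i := s)) = s ^ 2 + (\<Sum>k\<in>{..m} - {i}. y0 k ^ 2)" for s
      unfolding q_def using i by (subst sum.remove[of _ i]) auto
    have q0: "q y0 = y0 i ^ 2 + (\<Sum>k\<in>{..m} - {i}. y0 k ^ 2)"
      using q[of "y0 i"] by simp
    have "isCont (\<lambda>s. q (y0(i := s))) (y0 i)" unfolding q by (intro continuous_intros)
    hence "((\<lambda>s. q (y0(i := s))) \<longlongrightarrow> q (y0(i := y0 i))) (nhds (y0 i))"
      unfolding isCont_def by (rule tendsto_at_iff_tendsto_nhds[THEN iffD1])
    hence "eventually (\<lambda>s. q (y0(i := s)) < 1) (nhds (y0 i))"
      using q1 by (intro order_tendstoD) auto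
    then obtain d where d: "d > 0" "\<And>s. \<bar>s - y0 i\<bar> < d \<Longrightarrow> q (y0(i := s)) < 1"
      by (auto simp: eventually_nhds_metric dist_real_def)
    show ?thesis
    proof (rule second_derivative_at_min_nonneg[OF _ _ d(1)])
      show "((\<lambda>s. W (y0(i := s))) has_real_derivative P1 i (y0(i := s)) - 2 * e * s) (at s)" for s
        unfolding W_def U_def q P1_def by (auto intro!: derivative_eq_intros D)
      show "((\<lambda>s. P1 i (y0(i := s)) - 2 * e * s) has_real_derivative P2 i - 2 * e) (at (y0 i))"
      proof -
        have "((\<lambda>s. P1 i (y0(i := s))) has_real_derivative P2 i) (at (y0 i))"
          unfolding P1_def P2_def by (intro DERIV_sum D')
        from DERIV_diff[OF this DERIV_cmult[OF DERIV_ident, of "2 * e"]] show ?thesis by simp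
      qed
      show "W (y0(i := y0 i)) \<le> W (y0(i := s))" if "\<bar>s - y0 i\<bar> < d" for s
        using y0 d(2)[OF that] i by (auto simp: B_def intro!: y0(2))
    qed
  qed
  \<comment> \<open>Over all coordinates the second derivatives of \<open>U\<close> sum to its
    Laplacian 0, so this sum is also -2 e (m + 1), which is negative.\<close>
  hence "(\<Sum>i\<le>m. P2 i - 2 * e) \<ge> 0" by (intro sum_nonneg) auto
  moreover have "(\<Sum>i\<le>m. P2 i) = 0"
  proof -
    have "(\<Sum>i\<le>m. P2 i) = (\<Sum>n=1..N. \<Sum>i\<le>m. if n = 1 then 0 else poly_eval m (n - 2) (partial i (partial i (p n))) y0)"
      unfolding P2_def by (rule sum.swap)
    also have "\<dots> = (\<Sum>n=1..N. if n = 1 then 0 else poly_eval m (n - 2) (laplacian m (p n)) y0)"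
    proof (intro sum.cong refl)
      fix n
      have "poly_eval m k (laplacian m (p n)) y0 = (\<Sum>i\<le>m. poly_eval m k (partial i (partial i (p n))) y0)" for k
        using poly_eval_sum[of m k "\<lambda>_. 1" "\<lambda>i. partial i (partial i (p n))" "{..m}" y0]
        by (simp add: laplacian_def[abs_def])
      thus "(\<Sum>i\<le>m. if n = 1 then 0 else poly_eval m (n - 2) (partial i (partial i (p n))) y0) =
          (if n = 1 then 0 else poly_eval m (n - 2) (laplacian m (p n)) y0)" by simp
    qed
    also have "\<dots> = 0"
      by (intro sum.neutral) (simp add: harm poly_eval_def)
    finally show ?thesis .
  qed
  ultimately show False using e by (simp add: sum_subtractf mult_le_0_iff)
qed

subsection \<open>The generating function\<close>

text \<open>Undoes the normalisation: the factor (2l)_n / n! is the value of C_n^l at 1.\<close>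

definition gegenbauer_poly :: "real \<Rightarrow> nat \<Rightarrow> real \<Rightarrow> real" where
  "gegenbauer_poly l n t = pochhammer (2 * l) n / fact n * norm_gegenbauer l n t"

lemma gegenbauer_poly_rec:
  assumes "l \<ge> 0"
  shows "(real n + 2) * gegenbauer_poly l (Suc (Suc n)) t = 2 * (real n + 1 + l) * t * gegenbauer_poly l (Suc n) t - (real n + 2 * l) * gegenbauer_poly l n t"
proof -
  define c where "c = pochhammer (2 * l) n / fact n"
  have f1: "gegenbauer_poly l n t = c * norm_gegenbauer l n t" by (simp add: gegenbauer_poly_def c_def)
  have f2: "(real n + 1) * gegenbauer_poly l (Suc n) t = (2 * l + real n) * c * norm_gegenbauer l (Suc n) t"
    by (simp add: gegenbauer_poly_def c_def pochhammer_Suc divide_simps) (simp add: algebra_simps)?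
  have f3: "(real n + 1) * (real n + 2) * gegenbauer_poly l (Suc (Suc n)) t = (2 * l + real n) * (2 * l + real n + 1) * c * norm_gegenbauer l (Suc (Suc n)) t"
    by (simp add: gegenbauer_poly_def c_def pochhammer_Suc divide_simps) (simp add: algebra_simps)?
  have "(real n + 1) * ((real n + 2) * gegenbauer_poly l (Suc (Suc n)) t) =
      (real n + 1) * (2 * (real n + 1 + l) * t * gegenbauer_poly l (Suc n) t - (real n + 2 * l) * gegenbauer_poly l n t)"
    using f1 f2 f3 norm_gegenbauer_rec[OF assms, of n t] by algebra
  thus ?thesis by (subst (asm) mult_left_cancel) auto
qed

text \<open>The binomial series of (1 - r)^(-a). For a = 2l it dominates the generating series,
  since the normalised polynomials are bounded by 1.\<close>

lemma summable_pochhammer_fact: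
  fixes a r :: real
  assumes "\<bar>r\<bar> < 1"
  shows "summable (\<lambda>n. pochhammer a n / fact n * r ^ n)"
proof -
  have "(\<lambda>n. (- a gchoose n) * (- r) ^ n) sums (1 + - r) powr (- a)"
    by (rule gen_binomial_real) (use assms in auto)
  moreover have "(- a gchoose n) * (- r) ^ n = pochhammer a n / fact n * r ^ n" for n
    by (simp add: gbinomial_pochhammer flip: power_mult_distrib)
  ultimately show ?thesis by (simp add: sums_iff)
qed

text \<open>The ODE for the power series shows that its product with \<open>(1 + r\<^sup>2 - 2 r t)\<^sup>l\<close> is constant.\<close>

lemma gegenbauer_poly_generating_function:
  assumes "m \<ge> 2" "l = (real m - 1) / 2" "\<bar>t\<bar> \<le> 1" "\<bar>r\<bar> < 1"
  shows "(\<lambda>n. r ^ n * gegenbauer_poly l n t) sums ((1 + r\<^sup>2 - 2 * r * t) powr (- l))"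
proof -
  define F where "F = (\<lambda>r. \<Sum>n. gegenbauer_poly l n t * r ^ n)"
  define F' where "F' = (\<lambda>r. \<Sum>n. diffs (\<lambda>n. gegenbauer_poly l n t) n * r ^ n)"
  have l: "l > 0" using assms by simp
  have smb: "summable (\<lambda>n. gegenbauer_poly l n t * x ^ n)" if "\<bar>x\<bar> < 1" for x
  proof (rule summable_comparison_test')
    show "summable (\<lambda>n. pochhammer (2 * l) n / fact n * \<bar>x\<bar> ^ n)"
      by (rule summable_pochhammer_fact) (use that in auto)
    fix n
    have "pochhammer (2 * l) n / fact n \<ge> 0"
      using l by (intro divide_nonneg_nonneg pochhammer_nonneg) auto
    moreover have "\<bar>norm_gegenbauer l n t\<bar> \<le> 1"
      unfolding assms(2) by (rule abs_norm_gegenbauer_le_1) (use assms in auto)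
    ultimately show "norm (gegenbauer_poly l n t * x ^ n) \<le> pochhammer (2 * l) n / fact n * \<bar>x\<bar> ^ n"
      unfolding gegenbauer_poly_def real_norm_def abs_mult power_abs
      by (intro mult_right_mono) (simp_all only: abs_of_nonneg mult_left_le abs_ge_zero zero_le_power)
  qed
  have D: "(F has_real_derivative F' x) (at x)" if "\<bar>x\<bar> < 1" for x
    unfolding F_def F'_def
    by (rule termdiffs_strong'[where K = 1]) (use that smb in auto)
  have smb': "summable (\<lambda>n. diffs (\<lambda>n. gegenbauer_poly l n t) n * x ^ n)" if "\<bar>x\<bar> < 1" for x
    by (rule termdiff_converges[where K = 1]) (use that smb in auto)
  \<comment> \<open>Coefficient by coefficient this is \<open>gegenbauer_poly_rec\<close>. The shift
    \<open>sh\<close> below is multiplication by \<open>x\<close> on coefficient sequences.\<close>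
  have ode: "(1 + x\<^sup>2 - 2 * x * t) * F' x = 2 * l * (t - x) * F x" if x: "\<bar>x\<bar> < 1" for x
  proof -
    define a where "a = (\<lambda>n. gegenbauer_poly l n t)"
    have s1: "(\<lambda>n. diffs a n * x ^ n) sums F' x"
      using smb'[OF x] unfolding F'_def a_def by (rule summable_sums)
    have s2: "(\<lambda>n. a n * x ^ n) sums F x"
      using smb[OF x] unfolding F_def a_def by (rule summable_sums)
    define sh :: "(nat \<Rightarrow> real) \<Rightarrow> nat \<Rightarrow> real" where "sh = (\<lambda>f n. if n = 0 then 0 else f (n - 1))"
    have shift: "(\<lambda>n. sh f n * x ^ n) sums (x * s)" if "(\<lambda>n. f n * x ^ n) sums s" for f s
    proof -
      have "(\<lambda>n. sh f (Suc n) * x ^ Suc n) sums (x * s)"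
        using sums_mult[OF that, of x] by (simp add: sh_def mult_ac)
      thus ?thesis by (subst (asm) sums_Suc_iff) (simp add: sh_def)
    qed
    have "(\<lambda>n. diffs a n * x ^ n + sh (sh (diffs a)) n * x ^ n - 2 * t * (sh (diffs a) n * x ^ n)
        - (2 * l * t * (a n * x ^ n) - 2 * l * (sh a n * x ^ n)))
        sums (F' x + x * (x * F' x) - 2 * t * (x * F' x) - (2 * l * t * F x - 2 * l * (x * F x)))"
      by (intro sums_add sums_diff sums_mult shift s1 s2)
    moreover have "diffs a n * x ^ n + sh (sh (diffs a)) n * x ^ n - 2 * t * (sh (diffs a) n * x ^ n)
        - (2 * l * t * (a n * x ^ n) - 2 * l * (sh a n * x ^ n)) = 0" for n
    proof -
      have "diffs a n + sh (sh (diffs a)) n - 2 * t * sh (diffs a) n - (2 * l * t * a n - 2 * l * sh a n) = 0"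
      proof (cases n)
        case 0
        then show ?thesis by (simp add: diffs_def a_def gegenbauer_poly_def sh_def)
      next
        case (Suc k)
        then show ?thesis
          using gegenbauer_poly_rec[of l k t] l by (cases k) (simp_all add: diffs_def a_def sh_def algebra_simps)
      qed
      hence "(diffs a n + sh (sh (diffs a)) n - 2 * t * sh (diffs a) n - (2 * l * t * a n - 2 * l * sh a n)) * x ^ n = 0"
        by simp
      thus ?thesis by (simp add: algebra_simps)
    qed
    ultimately have "(\<lambda>n. 0) sums (F' x + x * (x * F' x) - 2 * t * (x * F' x) - (2 * l * t * F x - 2 * l * (x * F x)))"
      by simp
    hence "F' x + x * (x * F' x) - 2 * t * (x * F' x) - (2 * l * t * F x - 2 * l * (x * F x)) = 0"
      by (rule sums_unique2[OF _ sums_zero])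
    thus ?thesis by (simp add: power2_eq_square algebra_simps)
  qed
  have pos: "1 + x\<^sup>2 - 2 * x * t > 0" if "\<bar>x\<bar> < 1" for x
  proof -
    have "\<bar>x * t\<bar> \<le> \<bar>x\<bar> * 1" unfolding abs_mult using assms by (intro mult_left_mono) auto
    moreover have "(1 - \<bar>x\<bar>)\<^sup>2 > 0" using that by simp
    ultimately show ?thesis by (simp add: power2_eq_square algebra_simps)
  qed
  define G where "G = (\<lambda>x. F x * (1 + x\<^sup>2 - 2 * x * t) powr l)"
  have DG: "(G has_real_derivative 0) (at x)" if x: "\<bar>x\<bar> < 1" for x
  proof -
    define w where "w = 1 + x\<^sup>2 - 2 * x * t"
    have "w > 0" unfolding w_def by (rule pos[OF x])
    hence pw: "w powr l = w * w powr (l - 1)"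
      using powr_mult_base[of w "l - 1"] by simp
    have "(G has_real_derivative F' x * w powr l + F x * (l * w powr (l - 1) * (2 * x - 2 * t))) (at x)"
      unfolding G_def w_def using pos[OF x]
      by (auto intro!: derivative_eq_intros D x)
    also have "F' x * w powr l + F x * (l * w powr (l - 1) * (2 * x - 2 * t)) =
       w powr (l - 1) * (w * F' x - 2 * l * (t - x) * F x)"
      by (simp add: pw algebra_simps)
    also have "\<dots> = 0" using ode[OF x] by (simp add: w_def)
    finally show ?thesis .
  qed
  have "G r = G 0"
  proof (rule DERIV_zero_connected_constant[of "{-1<..<1}" "{}"])
    show "continuous_on {-1<..<1} G"
      by (intro continuous_at_imp_continuous_on ballI DERIV_isCont[OF DG]) (auto simp: abs_less_iff)
  qed (use DG assms in \<open>auto simp: abs_less_iff\<close>)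
  also have "G 0 = 1"
    unfolding G_def F_def powser_zero by (simp add: gegenbauer_poly_def)
  finally have "F r = (1 + r\<^sup>2 - 2 * r * t) powr (- l)"
    using pos[OF assms(4)] by (simp add: G_def powr_minus field_simps)
  moreover have "(\<lambda>n. gegenbauer_poly l n t * r ^ n) sums F r"
    unfolding F_def by (rule summable_sums[OF smb[OF assms(4)]])
  ultimately show ?thesis by (simp add: mult_ac)
qed

text \<open>The point 0 is left out of the hypothesis so that the induction step may divide the
  series by \<open>x\<close>; the leading coefficient is recovered as a limit at 0.\<close>

lemma power_series_zero:
  fixes c :: "nat \<Rightarrow> real"
  assumes "\<And>x. x \<noteq> 0 \<Longrightarrow> \<bar>x\<bar> < 1 \<Longrightarrow> (\<lambda>n. c n * x ^ n) sums 0"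
  shows "c n = 0"
  using assms
proof (induction n arbitrary: c)
  have z: "c 0 = 0" if "\<And>x. x \<noteq> 0 \<Longrightarrow> \<bar>x\<bar> < 1 \<Longrightarrow> (\<lambda>n. c n * x ^ n) sums 0" for c :: "nat \<Rightarrow> real"
  proof -
    have "((\<lambda>_ :: real. 0) \<longlongrightarrow> c 0) (at 0)"
      by (rule powser_limit_0_strong[of 1]) (use that in auto)
    thus ?thesis by (simp add: tendsto_const_iff)
  qed
  case 0
  then show ?case by (intro z)
  case (Suc n)
  show ?case
  proof (rule Suc.IH)
    fix x :: real assume x: "x \<noteq> 0" "\<bar>x\<bar> < 1"
    have "(\<lambda>n. c (Suc n) * x ^ Suc n) sums 0"
      using Suc.prems[OF x] z[OF Suc.prems] by (subst sums_Suc_iff) simp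
    hence "(\<lambda>n. c (Suc n) * x ^ Suc n / x) sums (0 / x)"
      by (rule sums_divide)
    thus "(\<lambda>n. c (Suc n) * x ^ n) sums 0" using x by simp
  qed
qed

text \<open>Resolves the \<open>THE\<close> in \<open>gegenbauer\<close>: the generating function
  gives existence, \<open>power_series_zero\<close> uniqueness.\<close>

lemma gegenbauer_eq_poly:
  assumes "m \<ge> 2" "\<bar>t\<bar> \<le> 1"
  shows "gegenbauer ((real m - 1) / 2) n t = gegenbauer_poly ((real m - 1) / 2) n t"
proof -
  define l where "l = (real m - 1) / 2"
  have "(THE C. \<forall>r\<in>{-1<..<1}. (\<lambda>m. r ^ m * C m) sums ((1 + r\<^sup>2 - 2 * r * t) powr (- l))) = (\<lambda>n. gegenbauer_poly l n t)"
  proof (rule the_equality)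
    show *: "\<forall>r\<in>{-1<..<1}. (\<lambda>n. r ^ n * gegenbauer_poly l n t) sums ((1 + r\<^sup>2 - 2 * r * t) powr (- l))"
      using gegenbauer_poly_generating_function[OF assms(1) l_def assms(2)] by auto
    fix C assume C: "\<forall>r\<in>{-1<..<1}. (\<lambda>m. r ^ m * C m) sums ((1 + r\<^sup>2 - 2 * r * t) powr (- l))"
    show "C = (\<lambda>n. gegenbauer_poly l n t)"
    proof (intro ext)
      fix n
      have "C n - gegenbauer_poly l n t = 0"
      proof (rule power_series_zero)
        fix r :: real assume "\<bar>r\<bar> < 1"
        hence "(\<lambda>m. r ^ m * C m - r ^ m * gegenbauer_poly l m t) sums
            ((1 + r\<^sup>2 - 2 * r * t) powr (- l) - (1 + r\<^sup>2 - 2 * r * t) powr (- l))"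
          using * C by (intro sums_diff) (auto simp: abs_less_iff)
        thus "(\<lambda>m. (C m - gegenbauer_poly l m t) * r ^ m) sums 0" by (simp add: algebra_simps)
      qed
      thus "C n = gegenbauer_poly l n t" by simp
    qed
  qed
  moreover have "l \<noteq> 0" using assms by (simp add: l_def)
  ultimately show ?thesis by (simp add: gegenbauer_def flip: l_def)
qed

lemma gegenbauer_ratio:
  assumes "m \<ge> 1" "\<bar>t\<bar> \<le> 1"
  shows "gegenbauer ((real m - 1) / 2) n t / gegenbauer ((real m - 1) / 2) n 1 = norm_gegenbauer ((real m - 1) / 2) n t"
proof (cases "m = 1")
  case True
  then show ?thesis
    using assms norm_gegenbauer_0_cos[of n "arccos t"] by (simp add: gegenbauer_def cos_arccos_abs)
next
  case False
  hence "pochhammer (2 * ((real m - 1) / 2)) n > 0"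
    using assms by (intro pochhammer_pos) auto
  thus ?thesis
    using False assms norm_gegenbauer_1[of "(real m - 1) / 2" n] gegenbauer_eq_poly[of m t n] gegenbauer_eq_poly[of m 1 n]
    by (simp add: gegenbauer_poly_def)
qed

subsection \<open>Schoenberg series\<close>

lemma topspace_nsphere_iff: "x \<in> topspace (nsphere m) \<longleftrightarrow> (\<forall>i>m. x i = 0) \<and> (\<Sum>i\<le>m. x i ^ 2) = 1"
  by (auto simp: nsphere topspace_subtopology)

lemma abs_inner_le_1:
  assumes "x \<in> topspace (nsphere m)" "y \<in> topspace (nsphere m)"
  shows "\<bar>\<Sum>i\<le>m. x i * y i\<bar> \<le> 1"
proof -
  have "(\<Sum>i\<le>m. x i * y i)\<^sup>2 \<le> (\<Sum>i\<le>m. (x i)\<^sup>2) * (\<Sum>i\<le>m. (y i)\<^sup>2)"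
    by (rule Cauchy_Schwarz_ineq_sum)
  thus ?thesis using assms by (simp add: topspace_nsphere_iff abs_square_le_1)
qed

lemma geodesic_dist_range:
  assumes "x \<in> topspace (nsphere m)" "y \<in> topspace (nsphere m)"
  shows "geodesic_dist m x y \<in> {0..pi}" "cos (geodesic_dist m x y) = (\<Sum>i\<le>m. x i * y i)"
  using abs_inner_le_1[OF assms]
  by (auto simp: geodesic_dist_def abs_le_iff cos_arccos_abs intro: arccos_lbound arccos_ubound)

lemma abs_norm_gegenbauer_cos_le_1: "m \<ge> 1 \<Longrightarrow> \<bar>norm_gegenbauer ((real m - 1) / 2) n (cos \<theta>)\<bar> \<le> 1"
  by (rule abs_norm_gegenbauer_le_1) auto

lemma norm_gegenbauer_series_continuous:
  assumes "m \<ge> 1" "summable (\<lambda>n. \<bar>a n\<bar>)"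
  assumes f: "\<And>\<theta>. \<theta> \<in> {0..pi} \<Longrightarrow> (\<lambda>n. a n * norm_gegenbauer ((real m - 1) / 2) n (cos \<theta>)) sums f \<theta>"
  shows "uniform_limit {0..pi} (\<lambda>N \<theta>. \<Sum>n<N. a n * norm_gegenbauer ((real m - 1) / 2) n (cos \<theta>)) f sequentially"
    "continuous_on {0..pi} f"
proof -
  define g where "g = (\<lambda>n \<theta>. a n * norm_gegenbauer ((real m - 1) / 2) n (cos \<theta>))"
  have l: "(real m - 1) / 2 \<ge> 0" using assms(1) by simp
  have "norm (g n \<theta>) \<le> \<bar>a n\<bar>" for n \<theta>
    using abs_norm_gegenbauer_cos_le_1[OF assms(1), of n \<theta>] by (simp add: g_def abs_mult mult_left_le)
  hence "uniform_limit {0..pi} (\<lambda>N \<theta>. \<Sum>n<N. g n \<theta>) (\<lambda>\<theta>. suminf (\<lambda>n. g n \<theta>)) sequentially"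
    by (rule Weierstrass_m_test[OF _ assms(2)])
  moreover have "suminf (\<lambda>n. g n \<theta>) = f \<theta>" if "\<theta> \<in> {0..pi}" for \<theta>
    using f[OF that] by (simp add: g_def sums_iff)
  ultimately show u: "uniform_limit {0..pi} (\<lambda>N \<theta>. \<Sum>n<N. g n \<theta>) f sequentially"
    by (subst (asm) uniform_limit_cong') auto
  have cn: "continuous_on UNIV (norm_gegenbauer ((real m - 1) / 2) n)" for n
    by (intro continuous_at_imp_continuous_on ballI DERIV_isCont[OF norm_gegenbauer_has_derivative[OF l]])
  have "continuous_on {0..pi} (\<lambda>\<theta>. norm_gegenbauer ((real m - 1) / 2) n (cos \<theta>))" for n
    by (rule continuous_on_compose2[OF cn]) (auto intro: continuous_intros)
  hence "continuous_on {0..pi} (\<lambda>\<theta>. \<Sum>n<N. g n \<theta>)" for N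
    unfolding g_def by (intro continuous_intros)
  thus "continuous_on {0..pi} f"
    by (intro uniform_limit_theorem[OF _ u]) auto
qed

lemma has_schoenberg_seq_iff:
  assumes "m \<ge> 1"
  shows "has_schoenberg_seq m f a \<longleftrightarrow> (\<forall>n. a n \<ge> 0) \<and> a sums 1 \<and>
     (\<forall>\<theta>\<in>{0..pi}. (\<lambda>n. a n * norm_gegenbauer ((real m - 1) / 2) n (cos \<theta>)) sums f \<theta>)"
  using assms by (simp add: has_schoenberg_seq_def gegenbauer_ratio)

lemma schoenberg_imp_Psi:
  assumes m: "m \<ge> 1" and S: "has_schoenberg_seq m f a"
  shows "f \<in> Psi m"
proof -
  have nonneg: "\<And>n. a n \<ge> 0" and sums1: "a sums 1"
    and series: "\<And>\<theta>. \<theta> \<in> {0..pi} \<Longrightarrow> (\<lambda>n. a n * norm_gegenbauer ((real m - 1) / 2) n (cos \<theta>)) sums f \<theta>"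
    using S unfolding has_schoenberg_seq_iff[OF m] by blast+
  have l: "(real m - 1) / 2 \<ge> 0" using m by simp
  have sm: "summable (\<lambda>n. \<bar>a n\<bar>)" using sums_summable[OF sums1] nonneg by simp
  have "continuous_on {0..pi} f"
    by (rule norm_gegenbauer_series_continuous(2)[OF m sm series])
  moreover have "a sums f 0"
    using series[of 0] by (simp add: norm_gegenbauer_1[OF l])
  hence "f 0 = 1"
    using sums1 by (rule sums_unique2)
  moreover have "positive_definite_on_sphere m (\<lambda>x y. f (geodesic_dist m x y))"
    unfolding positive_definite_on_sphere_def
  proof safe
    fix N :: nat and x :: "nat \<Rightarrow> nat \<Rightarrow> real" and c :: "nat \<Rightarrow> real"
    assume x: "\<forall>i\<in>{1..N}. x i \<in> topspace (nsphere m)"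
    have "(\<lambda>n. a n * norm_gegenbauer ((real m - 1) / 2) n (\<Sum>k\<le>m. x i k * x j k)) sums f (geodesic_dist m (x i) (x j))"
      if "i \<in> {1..N}" "j \<in> {1..N}" for i j
    proof -
      have "x i \<in> topspace (nsphere m)" "x j \<in> topspace (nsphere m)" using x that by auto
      note g = geodesic_dist_range[OF this]
      show ?thesis
        using series[OF g(1)] by (simp only: g(2))
    qed
    hence lim: "(\<lambda>n. \<Sum>i=1..N. \<Sum>j=1..N. c i * c j * (a n * norm_gegenbauer ((real m - 1) / 2) n (\<Sum>k\<le>m. x i k * x j k)))
       sums (\<Sum>i=1..N. \<Sum>j=1..N. c i * c j * f (geodesic_dist m (x i) (x j)))"
      by (intro sums_sum sums_mult)
    have nn: "(\<Sum>i=1..N. \<Sum>j=1..N. c i * c j * (a n * norm_gegenbauer ((real m - 1) / 2) n (\<Sum>k\<le>m. x i k * x j k))) \<ge> 0" for n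
    proof -
      have "(\<Sum>i=1..N. \<Sum>j=1..N. c i * c j * (a n * norm_gegenbauer ((real m - 1) / 2) n (\<Sum>k\<le>m. x i k * x j k))) =
        a n * (\<Sum>i=1..N. \<Sum>j=1..N. c i * c j * norm_gegenbauer ((real m - 1) / 2) n (\<Sum>k\<le>m. x i k * x j k))"
        unfolding sum_distrib_left by (intro sum.cong refl) (simp only: mult_ac)
      also have "\<dots> \<ge> 0"
      proof (intro mult_nonneg_nonneg norm_gegenbauer_gram_nonneg m)
        show "a n \<ge> 0" by (rule nonneg)
        show "(\<Sum>k\<le>m. (x i k)\<^sup>2) = 1" if "i \<in> {1..N}" for i
          using x that unfolding topspace_nsphere_iff by blast
      qed
      finally show ?thesis .
    qed
    show "(\<Sum>i=1..N. \<Sum>j=1..N. c i * c j * f (geodesic_dist m (x i) (x j))) \<ge> 0"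
      by (rule sums_le[OF nn sums_zero lim])
  qed
  ultimately show ?thesis by (simp add: Psi_def)
qed

text \<open>By the maximum principle each new point can be chosen so that the off-diagonal contribution
  of the non-constant part does not grow; hence that part is linear, not quadratic, in the number of points.\<close>

lemma exists_spread_points:
  assumes m: "m \<ge> 1" and a: "\<And>n. a n \<ge> 0"
  shows "\<exists>x :: nat \<Rightarrow> nat \<Rightarrow> real. (\<forall>i\<in>{1..K}. x i \<in> topspace (nsphere m)) \<and>
     (\<Sum>i=1..K. \<Sum>j=1..K. \<Sum>n=1..N. a n * norm_gegenbauer ((real m - 1) / 2) n (\<Sum>k\<le>m. x i k * x j k)) \<le> real K * (\<Sum>n=1..N. a n)"
proof (induction K)
  case (Suc K)
  then obtain x :: "nat \<Rightarrow> nat \<Rightarrow> real" where x: "\<And>i. i \<in> {1..K} \<Longrightarrow> x i \<in> topspace (nsphere m)"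
    "(\<Sum>i=1..K. \<Sum>j=1..K. \<Sum>n=1..N. a n * norm_gegenbauer ((real m - 1) / 2) n (\<Sum>k\<le>m. x i k * x j k)) \<le> real K * (\<Sum>n=1..N. a n)"
    by blast
  define \<phi> where "\<phi> = (\<lambda>x y. \<Sum>n=1..N. a n * norm_gegenbauer ((real m - 1) / 2) n (\<Sum>k\<le>m. x k * y k))"
  \<comment> \<open>The interaction of a new point with the chosen ones is harmonic in that point
    and has no constant term, so some point makes it at most 0. The new row and column then add at
    most the diagonal entry, the sum of the \<open>a n\<close>.\<close>
  define p where "p = (\<lambda>n \<alpha>. \<Sum>i=1..K. a n * zonal m (x i) n \<alpha>)"
  have "laplacian m (p n) = (\<lambda>_. 0)" for n
    using x(1) by (auto simp: p_def laplacian_sum laplacian_zonal[OF m] topspace_nsphere_iff fun_eq_iff intro!: sum.neutral)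
  then obtain y where y: "y \<in> topspace (nsphere m)" "(\<Sum>n=1..N. poly_eval m n (p n) y) \<le> 0"
    using harmonic_nonpos_on_sphere[of N m p] by (auto simp: topspace_nsphere_iff)
  have "(\<Sum>n=1..N. poly_eval m n (p n) y) = (\<Sum>n=1..N. \<Sum>i=1..K. a n * norm_gegenbauer ((real m - 1) / 2) n (\<Sum>k\<le>m. x i k * y k))"
    using y(1) by (simp add: p_def poly_eval_sum zonal_eval[OF m] topspace_nsphere_iff)
  also have "\<dots> = (\<Sum>i=1..K. \<phi> (x i) y)"
    unfolding \<phi>_def by (rule sum.swap)
  finally have le: "(\<Sum>i=1..K. \<phi> (x i) y) \<le> 0" using y(2) by simp
  have sym: "\<phi> u v = \<phi> v u" for u v by (simp add: \<phi>_def mult_ac)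
  have diag: "\<phi> y y = (\<Sum>n=1..N. a n)"
    using y(1) m by (simp add: \<phi>_def norm_gegenbauer_1 topspace_nsphere_iff flip: power2_eq_square)
  define x' where "x' = x(Suc K := y)"
  have x': "x' i = x i" if "i \<in> {1..K}" for i using that by (simp add: x'_def)
  have "(\<Sum>i=1..Suc K. \<Sum>j=1..Suc K. \<phi> (x' i) (x' j)) =
     (\<Sum>i=1..K. \<Sum>j=1..K. \<phi> (x' i) (x' j)) + 2 * (\<Sum>i=1..K. \<phi> (x' i) y) + \<phi> y y"
  proof -
    have "(\<Sum>j=1..K. \<phi> y (x' j)) = (\<Sum>i=1..K. \<phi> (x' i) y)" by (intro sum.cong sym refl)
    moreover have "x' (Suc K) = y" by (simp add: x'_def)
    ultimately show ?thesis by (simp add: sum.distrib)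
  qed
  also have "(\<Sum>i=1..K. \<Sum>j=1..K. \<phi> (x' i) (x' j)) = (\<Sum>i=1..K. \<Sum>j=1..K. \<phi> (x i) (x j))"
    by (intro sum.cong) (auto simp: x')
  also have "(\<Sum>i=1..K. \<phi> (x' i) y) = (\<Sum>i=1..K. \<phi> (x i) y)"
    by (intro sum.cong) (auto simp: x')
  also have "(\<Sum>i=1..K. \<Sum>j=1..K. \<phi> (x i) (x j)) + 2 * (\<Sum>i=1..K. \<phi> (x i) y) + \<phi> y y
      \<le> real (Suc K) * (\<Sum>n=1..N. a n)"
  proof -
    have "(\<Sum>i=1..K. \<Sum>j=1..K. \<phi> (x i) (x j)) \<le> real K * (\<Sum>n=1..N. a n)"
      using x(2) by (simp only: \<phi>_def)
    moreover have "real (Suc K) * (\<Sum>n=1..N. a n) = real K * (\<Sum>n=1..N. a n) + (\<Sum>n=1..N. a n)"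
      by (simp add: distrib_right)
    ultimately show ?thesis using le diag by linarith
  qed
  finally have "(\<Sum>i=1..Suc K. \<Sum>j=1..Suc K. \<phi> (x' i) (x' j)) \<le> real (Suc K) * (\<Sum>n=1..N. a n)" .
  moreover have "\<forall>i\<in>{1..Suc K}. x' i \<in> topspace (nsphere m)"
    using x(1) y(1) by (auto simp: x'_def)
  ultimately show ?case
    unfolding \<phi>_def by (intro exI[of _ x'] conjI)
qed auto

text \<open>At \<open>K\<close> spread points with all weights 1 the double sum is at most K^2 a_0 +
  K A + K^2 T_N: \<open>A\<close> bounds the sum of the coefficients of degrees 1 to N, and
  \<open>T N\<close> the higher degrees, whose polynomials are at most 1. Divide by K^2 and let N =
  K tend to infinity.\<close>

lemma positive_definite_imp_constant_term_nonneg: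
  assumes m: "m \<ge> 1" and a: "\<And>n. n \<ge> 1 \<Longrightarrow> a n \<ge> 0" and sm: "summable a"
    and f: "\<And>\<theta>. \<theta> \<in> {0..pi} \<Longrightarrow> (\<lambda>n. a n * norm_gegenbauer ((real m - 1) / 2) n (cos \<theta>)) sums f \<theta>"
    and pd: "positive_definite_on_sphere m (\<lambda>x y. f (geodesic_dist m x y))"
  shows "a 0 \<ge> 0"
proof -
  define A where "A = (\<Sum>n. a (Suc n))"
  define T where "T = (\<lambda>N. \<Sum>n. a (n + Suc N))"
  have smk: "summable (\<lambda>n. a (n + k))" for k using sm by (rule summable_ignore_initial_segment)
  have part: "(\<Sum>n=1..N. a n) \<le> A" for N
  proof -
    have "(\<Sum>n<N. a (Suc n)) \<le> A"
      unfolding A_def using smk[of 1] a by (intro sum_le_suminf) auto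
    thus ?thesis by (simp add: sum.atLeast1_atMost_eq)
  qed
  have key: "0 \<le> a 0 + A / real K + T N" if K: "K \<ge> 1" for K N
  proof -
    \<comment> \<open>\<open>max 0\<close> changes only \<open>a 0\<close>, whose sign is open and
      which does not occur in sums starting at 1; it makes \<open>exists_spread_points\<close>
      applicable.\<close>
    obtain x :: "nat \<Rightarrow> nat \<Rightarrow> real" where x: "\<forall>i\<in>{1..K}. x i \<in> topspace (nsphere m)"
      "(\<Sum>i=1..K. \<Sum>j=1..K. \<Sum>n=1..N. max 0 (a n) * norm_gegenbauer ((real m - 1) / 2) n (\<Sum>k\<le>m. x i k * x j k))
         \<le> real K * (\<Sum>n=1..N. max 0 (a n))"
      using exists_spread_points[OF m, of "\<lambda>n. max 0 (a n)" K N] by auto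
    have mx: "max 0 (a n) = a n" if "n \<in> {1..N}" for n using a[of n] that by auto
    have x2: "(\<Sum>i=1..K. \<Sum>j=1..K. \<Sum>n=1..N. a n * norm_gegenbauer ((real m - 1) / 2) n (\<Sum>k\<le>m. x i k * x j k))
         \<le> real K * (\<Sum>n=1..N. a n)"
    proof -
      have "(\<Sum>n=1..N. max 0 (a n) * g n) = (\<Sum>n=1..N. a n * g n)" "(\<Sum>n=1..N. max 0 (a n)) = (\<Sum>n=1..N. a n)" for g
        by (intro sum.cong refl; simp only: mx)+
      thus ?thesis using x(2) by (simp only:)
    qed
    have bd: "f (geodesic_dist m (x i) (x j)) \<le>
        a 0 + (\<Sum>n=1..N. a n * norm_gegenbauer ((real m - 1) / 2) n (\<Sum>k\<le>m. x i k * x j k)) + T N"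
      if ij: "i \<in> {1..K}" "j \<in> {1..K}" for i j
    proof -
      define t where "t = (\<Sum>k\<le>m. x i k * x j k)"
      have s: "(\<lambda>n. a n * norm_gegenbauer ((real m - 1) / 2) n t) sums f (geodesic_dist m (x i) (x j))"
        using f[of "geodesic_dist m (x i) (x j)"] geodesic_dist_range[of "x i" m "x j"] ij x(1) by (simp add: t_def)
      have t: "\<bar>t\<bar> \<le> 1" using abs_inner_le_1[of "x i" m "x j"] ij x(1) by (simp add: t_def)
      have "(\<lambda>n. a (n + Suc N) * norm_gegenbauer ((real m - 1) / 2) (n + Suc N) t) sums
          (f (geodesic_dist m (x i) (x j)) - (\<Sum>n<Suc N. a n * norm_gegenbauer ((real m - 1) / 2) n t))"
        by (rule sums_split_initial_segment[OF s])
      moreover have "(\<lambda>n. a (n + Suc N)) sums T N" unfolding T_def by (rule summable_sums[OF smk])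
      moreover have "a (n + Suc N) * norm_gegenbauer ((real m - 1) / 2) (n + Suc N) t \<le> a (n + Suc N)" for n
        using abs_norm_gegenbauer_le_1[OF m t, of "n + Suc N"] a[of "n + Suc N"] by (intro mult_left_le) auto
      ultimately have "f (geodesic_dist m (x i) (x j)) - (\<Sum>n<Suc N. a n * norm_gegenbauer ((real m - 1) / 2) n t) \<le> T N"
        by (rule sums_le[rotated 1])
      moreover have "(\<Sum>n<Suc N. a n * norm_gegenbauer ((real m - 1) / 2) n t) = a 0 + (\<Sum>n=1..N. a n * norm_gegenbauer ((real m - 1) / 2) n t)"
        by (simp add: sum.lessThan_Suc_shift sum.atLeast1_atMost_eq del: sum.lessThan_Suc)
      ultimately show ?thesis by (simp add: t_def)
    qed
    have "0 \<le> (\<Sum>i=1..K. \<Sum>j=1..K. f (geodesic_dist m (x i) (x j)))"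
      using pd[unfolded positive_definite_on_sphere_def, rule_format, OF K, of x "\<lambda>_. 1"] x(1) by simp
    also have "\<dots> \<le> (\<Sum>i=1..K. \<Sum>j=1..K. a 0 + (\<Sum>n=1..N. a n * norm_gegenbauer ((real m - 1) / 2) n (\<Sum>k\<le>m. x i k * x j k)) + T N)"
      by (intro sum_mono bd)
    also have "\<dots> \<le> real K ^ 2 * a 0 + real K * A + real K ^ 2 * T N"
      using x2 mult_left_mono[OF part[of N], of "real K"]
      by (simp add: sum.distrib power2_eq_square mult.assoc)
    finally have "0 \<le> (real K ^ 2 * a 0 + real K * A + real K ^ 2 * T N) / real K ^ 2" by simp
    also have "\<dots> = a 0 + A / real K + T N"
      using K by (simp add: add_divide_distrib power2_eq_square)
    finally show ?thesis .
  qed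
  have "T \<longlonglongrightarrow> 0"
    unfolding T_def suminf_minus_initial_segment[OF sm]
    using tendsto_diff[OF tendsto_const LIMSEQ_Suc[OF summable_LIMSEQ[OF sm]], of "suminf a"] by simp
  hence "(\<lambda>K. a 0 + A / real K + T K) \<longlonglongrightarrow> a 0 + 0 + 0"
    by (intro tendsto_intros lim_const_over_n)
  moreover have "eventually (\<lambda>K. 0 \<le> a 0 + A / real K + T K) sequentially"
    using eventually_ge_at_top[of 1] by eventually_elim (rule key)
  ultimately show ?thesis
    using tendsto_lowerbound[of _ "a 0 + 0 + 0" sequentially 0] by simp
qed

subsection \<open>The montee\<close>

text \<open>Termwise integration by uniform convergence, stated for a general weight: it is applied
  with sin for the montee and with \<open>montee_weight d\<close> for the integral formula of
  c(d).\<close>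

lemma norm_gegenbauer_series_integral:
  fixes a :: "nat \<Rightarrow> real"
  assumes m: "m \<ge> 1" and sm: "summable (\<lambda>n. \<bar>a n\<bar>)" and \<theta>: "\<theta> \<in> {0..pi}"
    and f: "\<And>\<beta>. \<beta> \<in> {0..pi} \<Longrightarrow> (\<lambda>n. a n * norm_gegenbauer ((real m - 1) / 2) n (cos \<beta>)) sums f \<beta>"
    and w: "continuous_on {0..pi} w"
    and I: "\<And>n. ((\<lambda>\<beta>. w \<beta> * norm_gegenbauer ((real m - 1) / 2) n (cos \<beta>)) has_integral I n) {\<theta>..pi}"
  shows "(\<lambda>n. a n * I n) sums integral {\<theta>..pi} (\<lambda>\<beta>. w \<beta> * f \<beta>)"
proof -
  have l: "(real m - 1) / 2 \<ge> 0" using m by simp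
  have sub: "{\<theta>..pi} \<subseteq> {0..pi}" using \<theta> by auto
  define g where "g = (\<lambda>n \<beta>. w \<beta> * norm_gegenbauer ((real m - 1) / 2) n (cos \<beta>))"
  obtain M where M: "\<And>\<beta>. \<beta> \<in> {0..pi} \<Longrightarrow> \<bar>w \<beta>\<bar> \<le> M"
    using compact_imp_bounded[OF compact_continuous_image[OF w compact_Icc]]
    unfolding bounded_iff by (metis image_eqI real_norm_def)
  have bd: "norm (a n * g n \<beta>) \<le> M * \<bar>a n\<bar>" if "\<beta> \<in> {\<theta>..pi}" for n \<beta>
  proof -
    have "\<bar>w \<beta>\<bar> * \<bar>norm_gegenbauer ((real m - 1) / 2) n (cos \<beta>)\<bar> \<le> M * 1"
      using M[of \<beta>] that sub abs_norm_gegenbauer_cos_le_1[OF m, of n \<beta>] by (intro mult_mono) (auto intro: order_trans)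
    hence "\<bar>a n\<bar> * (\<bar>w \<beta>\<bar> * \<bar>norm_gegenbauer ((real m - 1) / 2) n (cos \<beta>)\<bar>) \<le> \<bar>a n\<bar> * (M * 1)"
      by (rule mult_left_mono) simp
    thus ?thesis by (simp add: g_def abs_mult mult_ac)
  qed
  have "uniform_limit {\<theta>..pi} (\<lambda>N \<beta>. \<Sum>n<N. a n * g n \<beta>) (\<lambda>\<beta>. suminf (\<lambda>n. a n * g n \<beta>)) sequentially"
    by (rule Weierstrass_m_test[OF bd summable_mult[OF sm]])
  moreover have eq: "suminf (\<lambda>n. a n * g n \<beta>) = w \<beta> * f \<beta>" if "\<beta> \<in> {\<theta>..pi}" for \<beta>
    using sums_mult[OF f[of \<beta>], of "w \<beta>"] that sub
    by (intro sums_unique[symmetric]) (auto simp: g_def mult_ac)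
  ultimately have u: "uniform_limit {\<theta>..pi} (\<lambda>N \<beta>. \<Sum>n<N. a n * g n \<beta>) (\<lambda>\<beta>. w \<beta> * f \<beta>) sequentially"
    by (subst (asm) uniform_limit_cong') auto
  have cn: "continuous_on UNIV (norm_gegenbauer ((real m - 1) / 2) n)" for n
    by (intro continuous_at_imp_continuous_on ballI DERIV_isCont[OF norm_gegenbauer_has_derivative[OF l]])
  have "continuous_on {\<theta>..pi} (\<lambda>\<beta>. norm_gegenbauer ((real m - 1) / 2) n (cos \<beta>))" for n
    by (rule continuous_on_compose2[OF cn]) (auto intro: continuous_intros)
  hence c: "continuous_on {\<theta>..pi} (\<lambda>\<beta>. \<Sum>n<N. a n * g n \<beta>)" for N
    unfolding g_def by (intro continuous_intros continuous_on_subset[OF w sub])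
  obtain I' J where J: "\<And>N. ((\<lambda>\<beta>. \<Sum>n<N. a n * g n \<beta>) has_integral I' N) {\<theta>..pi}"
    "((\<lambda>\<beta>. w \<beta> * f \<beta>) has_integral J) {\<theta>..pi}" "I' \<longlonglongrightarrow> J"
    using uniform_limit_integral[OF u c] by auto
  have "((\<lambda>\<beta>. \<Sum>n<N. a n * g n \<beta>) has_integral (\<Sum>n<N. a n * I n)) {\<theta>..pi}" for N
    unfolding g_def by (intro has_integral_sum has_integral_mult_right I) auto
  hence "I' = (\<lambda>N. \<Sum>n<N. a n * I n)"
    using has_integral_unique[OF J(1)] by auto
  hence "(\<lambda>n. a n * I n) sums J"
    using J(3) by (simp add: sums_def)
  thus ?thesis using J(2) by (simp add: integral_unique)
qed

text \<open>The reciprocal of the constant in \<open>norm_gegenbauer_has_derivative\<close> for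
  degree n + 1 and parameter (d - 3)/2.\<close>

definition montee_coeff :: "nat \<Rightarrow> nat \<Rightarrow> real" where
  "montee_coeff d n = (real d - 2) / ((real n + 1) * (real n + real d - 2))"

lemma montee_coeff_pos: "d \<ge> 3 \<Longrightarrow> montee_coeff d n > 0"
  by (simp add: montee_coeff_def)

lemma montee_coeff_le_1:
  assumes "d \<ge> 3"
  shows "montee_coeff d n \<le> 1"
proof -
  have "1 * (real d - 2) \<le> (real n + 1) * (real n + real d - 2)"
    using assms by (intro mult_mono) auto
  thus ?thesis using assms by (simp add: montee_coeff_def divide_le_eq)
qed

lemma norm_gegenbauer_cos_primitive:
  assumes "d \<ge> 3"
  shows "((\<lambda>\<beta>. - montee_coeff d n * norm_gegenbauer ((real d - 3) / 2) (Suc n) (cos \<beta>)) has_real_derivative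
           sin \<beta> * norm_gegenbauer ((real d - 1) / 2) n (cos \<beta>)) (at \<beta>)"
proof -
  have l: "(real d - 3) / 2 \<ge> 0" using assms by simp
  have l1: "(real d - 3) / 2 + 1 = (real d - 1) / 2" by (simp add: field_simps)
  have "((\<lambda>\<beta>. - montee_coeff d n * norm_gegenbauer ((real d - 3) / 2) (Suc n) (cos \<beta>)) has_real_derivative
     - montee_coeff d n * (real (Suc n) * (real (Suc n) + 2 * ((real d - 3) / 2)) / (1 + 2 * ((real d - 3) / 2))
        * norm_gegenbauer ((real d - 3) / 2 + 1) (Suc n - 1) (cos \<beta>) * - sin \<beta>)) (at \<beta>)"
    by (intro DERIV_cmult DERIV_chain2[OF norm_gegenbauer_has_derivative[OF l]] DERIV_cos)
  moreover have "montee_coeff d n * (real (Suc n) * (real (Suc n) + 2 * ((real d - 3) / 2)) / (1 + 2 * ((real d - 3) / 2))) = 1"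
  proof -
    have e: "2 * ((real d - 3) / 2) = real d - 3" by simp
    have "real d - 2 > 0" "real n + real d - 2 > 0" using assms by auto
    thus ?thesis unfolding montee_coeff_def e by (simp add: divide_simps)
  qed
  hence "- montee_coeff d n * (real (Suc n) * (real (Suc n) + 2 * ((real d - 3) / 2)) / (1 + 2 * ((real d - 3) / 2))
        * norm_gegenbauer ((real d - 3) / 2 + 1) (Suc n - 1) (cos \<beta>) * - sin \<beta>) = sin \<beta> * norm_gegenbauer ((real d - 1) / 2) n (cos \<beta>)"
    unfolding l1 by (simp only: mult_minus_right mult_minus_left minus_minus diff_Suc_1) algebra
  ultimately show ?thesis by simp
qed

text \<open>The summand (-1)^n is the boundary value at pi; summed against the coefficients
  \<open>b n\<close> these constants make up c(d).\<close>

lemma has_integral_sin_norm_gegenbauer: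
  assumes "d \<ge> 3" "\<theta> \<in> {0..pi}"
  shows "((\<lambda>\<beta>. sin \<beta> * norm_gegenbauer ((real d - 1) / 2) n (cos \<beta>)) has_integral
           montee_coeff d n * (norm_gegenbauer ((real d - 3) / 2) (Suc n) (cos \<theta>) + (-1) ^ n)) {\<theta>..pi}"
proof -
  have l: "(real d - 3) / 2 \<ge> 0" using assms by simp
  have "((\<lambda>\<beta>. sin \<beta> * norm_gegenbauer ((real d - 1) / 2) n (cos \<beta>)) has_integral
     (- montee_coeff d n * norm_gegenbauer ((real d - 3) / 2) (Suc n) (cos pi)) - (- montee_coeff d n * norm_gegenbauer ((real d - 3) / 2) (Suc n) (cos \<theta>))) {\<theta>..pi}"
    by (rule fundamental_theorem_of_calculus)
       (use assms in \<open>simp_all only: atLeastAtMost_iff has_field_derivative_at_within[OF norm_gegenbauer_cos_primitive]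
         flip: has_real_derivative_iff_has_vector_derivative\<close>)
  moreover have "norm_gegenbauer ((real d - 3) / 2) (Suc n) (cos pi) = - ((-1) ^ n)"
    using norm_gegenbauer_minus[of "(real d - 3) / 2" "Suc n" 1] norm_gegenbauer_1[OF l, of "Suc n"] by simp
  ultimately show ?thesis by (simp add: algebra_simps)
qed

section \<open>The montee of a fixed Schoenberg series\<close>

context
  fixes d :: nat and \<psi> :: "real \<Rightarrow> real" and b :: "nat \<Rightarrow> real"
  assumes d: "d \<ge> 3" and S: "has_schoenberg_seq d \<psi> b"
begin

lemma coeff_nonneg: "b n \<ge> 0" and coeffs_sum_1: "b sums 1"
  and schoenberg_series: "\<theta> \<in> {0..pi} \<Longrightarrow> (\<lambda>n. b n * norm_gegenbauer ((real d - 1) / 2) n (cos \<theta>)) sums \<psi> \<theta>"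
  using S d by (auto simp: has_schoenberg_seq_iff)

lemma coeffs_abs_summable: "summable (\<lambda>n. \<bar>b n\<bar>)"
  using sums_summable[OF coeffs_sum_1] coeff_nonneg by simp

lemma schoenberg_continuous: "continuous_on {0..pi} \<psi>"
  by (rule norm_gegenbauer_series_continuous(2)[OF _ coeffs_abs_summable schoenberg_series]) (use d in auto)

lemma summable_montee_terms:
  assumes "\<And>n. \<bar>s n\<bar> \<le> 1"
  shows "summable (\<lambda>n. b n * (montee_coeff d n * s n))"
proof (rule summable_comparison_test'[OF coeffs_abs_summable])
  fix n
  have "\<bar>montee_coeff d n * s n\<bar> \<le> 1 * 1"
    unfolding abs_mult using montee_coeff_pos[OF d, of n] montee_coeff_le_1[OF d, of n] assms[of n]
    by (intro mult_mono) auto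
  thus "norm (b n * (montee_coeff d n * s n)) \<le> \<bar>b n\<bar>"
    by (simp add: abs_mult[of "b n"] mult_left_le)
qed

lemma schoenberg_c_sums: "(\<lambda>n. b n * (montee_coeff d n * (-1) ^ n)) sums schoenberg_c d b"
proof -
  have "schoenberg_c d b = (\<Sum>n. b n * (montee_coeff d n * (-1) ^ n))"
    by (simp add: schoenberg_c_def montee_coeff_def mult_ac)
  thus ?thesis
    using summable_sums[OF summable_montee_terms[of "\<lambda>n. (-1) ^ n"]] by simp
qed

text \<open>Coefficients of the montee before division. They are kept apart from the quotient
  because positivity of \<open>schoenberg_G1\<close> has a different source in each direction of
  (a).\<close>

definition numerator_seq :: "nat \<Rightarrow> real" where
  "numerator_seq n = (if n = 0 then schoenberg_c d b else b (n - 1) * montee_coeff d (n - 1))"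

lemma numerator_series:
  assumes \<theta>: "\<theta> \<in> {0..pi}"
  shows "(\<lambda>n. numerator_seq n * norm_gegenbauer ((real (d - 2) - 1) / 2) n (cos \<theta>)) sums
     integral {\<theta>..pi} (\<lambda>\<beta>. sin \<beta> * \<psi> \<beta>)"
proof -
  have d2: "(real (d - 2) - 1) / 2 = (real d - 3) / 2" using d by (simp add: of_nat_diff)
  have "(\<lambda>n. b n * (montee_coeff d n * (norm_gegenbauer ((real d - 3) / 2) (Suc n) (cos \<theta>) + (-1) ^ n))) sums
      integral {\<theta>..pi} (\<lambda>\<beta>. sin \<beta> * \<psi> \<beta>)"
    by (rule norm_gegenbauer_series_integral[OF _ coeffs_abs_summable \<theta> schoenberg_series _ has_integral_sin_norm_gegenbauer[OF d \<theta>]])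
       (use d in \<open>auto intro: continuous_intros\<close>)
  from sums_diff[OF this schoenberg_c_sums]
  have "(\<lambda>n. numerator_seq (Suc n) * norm_gegenbauer ((real d - 3) / 2) (Suc n) (cos \<theta>)) sums
      (integral {\<theta>..pi} (\<lambda>\<beta>. sin \<beta> * \<psi> \<beta>) - schoenberg_c d b)"
    by (simp add: numerator_seq_def algebra_simps)
  thus ?thesis
    unfolding d2 by (subst (asm) sums_Suc_iff) (simp add: numerator_seq_def)
qed

lemma even_part_sums:
  "(\<lambda>n. b n * (montee_coeff d n * (1 + (-1) ^ n))) sums integral {0..pi} (\<lambda>\<beta>. sin \<beta> * \<psi> \<beta>)"
proof -
  have l: "(real d - 3) / 2 \<ge> 0" using d by simp
  have "(\<lambda>n. b n * (montee_coeff d n * (norm_gegenbauer ((real d - 3) / 2) (Suc n) (cos 0) + (-1) ^ n))) sums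
      integral {0..pi} (\<lambda>\<beta>. sin \<beta> * \<psi> \<beta>)"
    by (rule norm_gegenbauer_series_integral[OF _ coeffs_abs_summable _ schoenberg_series _ has_integral_sin_norm_gegenbauer[OF d]])
       (use d in \<open>auto intro: continuous_intros\<close>)
  thus ?thesis by (simp add: norm_gegenbauer_1[OF l])
qed

lemma total_integral: "integral {0..pi} (\<lambda>\<beta>. sin \<beta> * \<psi> \<beta>) = schoenberg_G1 d b"
proof -
  define h where "h = (\<lambda>n. b n * (montee_coeff d n * (1 + (-1) ^ n)))"
  have "h sums integral {0..pi} (\<lambda>\<beta>. sin \<beta> * \<psi> \<beta>)"
    unfolding h_def by (rule even_part_sums)
  hence "(\<lambda>n. h (2 * n)) sums integral {0..pi} (\<lambda>\<beta>. sin \<beta> * \<psi> \<beta>)"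
  proof (subst sums_mono_reindex)
    show "h n = 0" if "n \<notin> range ((*) 2)" for n
      using that by (cases "even n") (auto simp: h_def elim!: evenE)
  qed (auto simp: strict_mono_def)
  moreover have "h (2 * n) = 2 * (real d - 2) * (b (2 * n) / ((2 * real n + 1) * (2 * real n + real d - 2)))" for n
    by (simp add: h_def montee_coeff_def)
  ultimately have "(\<lambda>n. 2 * (real d - 2) * (b (2 * n) / ((2 * real n + 1) * (2 * real n + real d - 2)))) sums
      integral {0..pi} (\<lambda>\<beta>. sin \<beta> * \<psi> \<beta>)"
    by simp
  hence "(\<lambda>n. 2 * (real d - 2) * (b (2 * n) / ((2 * real n + 1) * (2 * real n + real d - 2))) / (2 * (real d - 2))) sums
      (integral {0..pi} (\<lambda>\<beta>. sin \<beta> * \<psi> \<beta>) / (2 * (real d - 2)))"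
    by (rule sums_divide)
  hence "(\<lambda>n. b (2 * n) / ((2 * real n + 1) * (2 * real n + real d - 2))) sums
      (integral {0..pi} (\<lambda>\<beta>. sin \<beta> * \<psi> \<beta>) / (2 * (real d - 2)))"
    using d by simp
  thus ?thesis
    using d by (simp add: schoenberg_G1_def sums_iff)
qed

lemma montee_terms_sum_pos: "(\<Sum>n. b n * montee_coeff d n) > 0"
proof -
  have sm: "summable (\<lambda>n. b n * montee_coeff d n)"
    using summable_montee_terms[of "\<lambda>_. 1"] by simp
  have nn: "b n * montee_coeff d n \<ge> 0" for n
    using coeff_nonneg montee_coeff_pos[OF d, of n] by simp
  have "\<exists>n. b n \<noteq> 0"
  proof (rule ccontr)
    assume "\<not> (\<exists>n. b n \<noteq> 0)"
    hence "b sums 0" by (simp add: sums_0)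
    with coeffs_sum_1 show False using sums_unique2 zero_neq_one by blast
  qed
  then obtain n where "b n \<noteq> 0" by blast
  hence "b n * montee_coeff d n > 0"
    using coeff_nonneg[of n] montee_coeff_pos[OF d, of n] by simp
  thus ?thesis by (rule suminf_pos2[OF sm nn])
qed

lemma numerator_sums: "numerator_seq sums schoenberg_G1 d b"
  using numerator_series[of 0] d norm_gegenbauer_1[of "(real (d - 2) - 1) / 2"]
  by (simp add: total_integral)

lemma schoenberg_G1_eq: "schoenberg_G1 d b = schoenberg_c d b + (\<Sum>n. b n * montee_coeff d n)"
proof -
  have "(\<lambda>n. numerator_seq (Suc n)) sums (schoenberg_G1 d b - schoenberg_c d b)"
    using numerator_sums by (subst sums_Suc_iff) (simp add: numerator_seq_def)
  thus ?thesis by (simp add: numerator_seq_def sums_iff)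
qed

text \<open>Well-definedness of the montee says only that its denominator is nonzero; this supplies
  the sign.\<close>

lemma schoenberg_G1_nonneg: "schoenberg_G1 d b \<ge> 0"
  unfolding total_integral[symmetric]
proof (rule sums_le[OF _ sums_zero even_part_sums])
  fix n
  show "0 \<le> b n * (montee_coeff d n * (1 + (-1) ^ n))"
    using coeff_nonneg[of n] montee_coeff_pos[OF d, of n] by (cases "even n") auto
qed

lemma montee_seq_eq: "montee_seq d b n = numerator_seq n / schoenberg_G1 d b"
  using d by (auto simp: montee_seq_def numerator_seq_def montee_coeff_def of_nat_diff field_simps)

lemma montee_has_schoenberg_seq:
  assumes c: "schoenberg_c d b \<ge> 0"
  shows "has_schoenberg_seq (d - 2) (montee \<psi>) (montee_seq d b)"
proof -
  have G: "schoenberg_G1 d b > 0" using c montee_terms_sum_pos schoenberg_G1_eq by linarith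
  have "numerator_seq n \<ge> 0" for n
    using c coeff_nonneg[of "n - 1"] montee_coeff_pos[OF d, of "n - 1"] by (simp add: numerator_seq_def)
  moreover have "(\<lambda>n. numerator_seq n / schoenberg_G1 d b * norm_gegenbauer ((real (d - 2) - 1) / 2) n (cos \<theta>)) sums montee \<psi> \<theta>"
    if "\<theta> \<in> {0..pi}" for \<theta>
    using sums_divide[OF numerator_series[OF that], of "schoenberg_G1 d b"] by (simp add: montee_def total_integral)
  moreover have "(\<lambda>n. numerator_seq n / schoenberg_G1 d b) sums 1"
    using sums_divide[OF numerator_sums, of "schoenberg_G1 d b"] G by simp
  moreover have "montee_seq d b = (\<lambda>n. numerator_seq n / schoenberg_G1 d b)"
    by (simp add: fun_eq_iff montee_seq_eq)
  moreover have "d - 2 \<ge> 1" using d by simp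
  ultimately show ?thesis
    using G by (simp only: has_schoenberg_seq_iff divide_nonneg_pos) blast
qed

lemma montee_in_Psi_iff: "montee_well_defined \<psi> \<and> montee \<psi> \<in> Psi (d - 2) \<longleftrightarrow> schoenberg_c d b \<ge> 0"
proof
  assume c: "schoenberg_c d b \<ge> 0"
  have "schoenberg_G1 d b > 0" using c montee_terms_sum_pos schoenberg_G1_eq by linarith
  moreover have "(\<lambda>\<beta>. sin \<beta> * \<psi> \<beta>) absolutely_integrable_on {0..pi}"
    by (intro absolutely_integrable_continuous_real continuous_intros schoenberg_continuous)
  ultimately have "montee_well_defined \<psi>"
    by (simp add: montee_well_defined_def total_integral)
  moreover have "montee \<psi> \<in> Psi (d - 2)"
    by (rule schoenberg_imp_Psi[OF _ montee_has_schoenberg_seq[OF c]]) (use d in simp)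
  ultimately show "montee_well_defined \<psi> \<and> montee \<psi> \<in> Psi (d - 2)" ..
next
  assume A: "montee_well_defined \<psi> \<and> montee \<psi> \<in> Psi (d - 2)"
  hence G: "schoenberg_G1 d b > 0"
    using schoenberg_G1_nonneg by (simp add: montee_well_defined_def total_integral)
  have "numerator_seq 0 / schoenberg_G1 d b \<ge> 0"
  proof (rule positive_definite_imp_constant_term_nonneg)
    show "1 \<le> d - 2" using d by simp
    show "numerator_seq n / schoenberg_G1 d b \<ge> 0" if "n \<ge> 1" for n
      using that coeff_nonneg[of "n - 1"] montee_coeff_pos[OF d, of "n - 1"] G by (simp add: numerator_seq_def)
    show "summable (\<lambda>n. numerator_seq n / schoenberg_G1 d b)"
      using numerator_sums by (intro summable_divide) (rule sums_summable)
    show "(\<lambda>n. numerator_seq n / schoenberg_G1 d b * norm_gegenbauer ((real (d - 2) - 1) / 2) n (cos \<theta>)) sums montee \<psi> \<theta>"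
      if "\<theta> \<in> {0..pi}" for \<theta>
      using sums_divide[OF numerator_series[OF that], of "schoenberg_G1 d b"] by (simp add: montee_def total_integral)
    show "positive_definite_on_sphere (d - 2) (\<lambda>x y. montee \<psi> (geodesic_dist (d - 2) x y))"
      using A by (simp add: Psi_def)
  qed
  thus "schoenberg_c d b \<ge> 0" using G by (simp add: numerator_seq_def zero_le_divide_iff)
qed

end

subsection \<open>The weight function\<close>

text \<open>\<open>(real n + 1) * beta_const n\<close> is the reciprocal of the integral of sin^n
  over [0, pi]. For n = d - 3, \<open>beta_const n\<close> is the constant of the hypergeometric
  form of f_d.\<close>

definition beta_const :: "nat \<Rightarrow> real" where
  "beta_const n = 2 ^ n * (Gamma ((real n + 2) / 2))\<^sup>2 / (pi * Gamma (real n + 2))"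

text \<open>The distribution function of the probability density proportional to $\sin^n$ on $[0,\pi]$.\<close>

fun sin_cdf :: "nat \<Rightarrow> real \<Rightarrow> real" where
  "sin_cdf 0 \<theta> = \<theta> / pi"
| "sin_cdf (Suc 0) \<theta> = (1 - cos \<theta>) / 2"
| "sin_cdf (Suc (Suc n)) \<theta> = sin_cdf n \<theta> - beta_const n * cos \<theta> * sin \<theta> ^ Suc n"

lemma beta_const_0: "beta_const 0 = 1 / pi"
  using Gamma_fact[of 1, where ?'a = real] by (simp add: beta_const_def)

lemma beta_const_1: "beta_const (Suc 0) = 1 / 4"
proof -
  have "Gamma (3 / 2 :: real) = sqrt pi / 2"
    using Gamma_plus1[of "1 / 2 :: real"] Gamma_one_half_real nonpos_Ints_nonpos[of "1 / 2 :: real"] by force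
  hence "(Gamma (3 / 2 :: real))\<^sup>2 = pi / 4"
    by (simp only: power_divide real_sqrt_pow2 pi_ge_zero) simp
  moreover have "Gamma (3 :: real) = 2"
    using Gamma_fact[of 2, where ?'a = real] by (simp add: fact_numeral)
  ultimately show ?thesis by (simp add: beta_const_def)
qed

lemma beta_const_rec: "(real n + 3) * beta_const (Suc (Suc n)) = (real n + 2) * beta_const n"
proof -
  have g1: "Gamma ((real n + 2) / 2 + 1) = (real n + 2) / 2 * Gamma ((real n + 2) / 2)"
    by (rule Gamma_plus1) (auto elim!: nonpos_Ints_cases)
  have g2: "Gamma (real n + 2 + 1) = (real n + 2) * Gamma (real n + 2)"
    by (rule Gamma_plus1) (auto elim!: nonpos_Ints_cases)
  have g3: "Gamma (real n + 2 + 1 + 1) = (real n + 3) * Gamma (real n + 2 + 1)"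
    by (subst Gamma_plus1) (auto elim!: nonpos_Ints_cases)
  define A where "A = Gamma ((real n + 2) / 2)"
  define B where "B = Gamma (real n + 2)"
  have "(real (Suc (Suc n)) + 2) / 2 = (real n + 2) / 2 + 1" by (simp add: field_simps)
  hence h1: "Gamma ((real (Suc (Suc n)) + 2) / 2) = (real n + 2) / 2 * A"
    by (simp only: g1 A_def)
  have "real (Suc (Suc n)) + 2 = real n + 2 + 1 + 1" by simp
  hence h2: "Gamma (real (Suc (Suc n)) + 2) = (real n + 3) * ((real n + 2) * B)"
    by (simp only: g2 g3 B_def)
  have "B > 0" unfolding B_def by (rule Gamma_real_pos) simp
  thus ?thesis
    unfolding beta_const_def h1 h2 A_def[symmetric] B_def[symmetric]
    by (simp add: divide_simps power2_eq_square)
qed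

lemma beta_const_pos: "beta_const n > 0"
  unfolding beta_const_def by (intro divide_pos_pos mult_pos_pos zero_less_power Gamma_real_pos) (auto intro!: Gamma_real_pos)

text \<open>The recursion of \<open>sin_cdf\<close> is the reduction formula for integrals of sin^n.
  By sin^2 + cos^2 = 1 its derivative is (n + 2) \<open>beta_const n\<close> sin^(n+2), and
  \<open>beta_const_rec\<close>, a Wallis recursion, restores the stated form.\<close>

lemma sin_cdf_has_derivative:
  "(sin_cdf n has_real_derivative (real n + 1) * beta_const n * sin \<theta> ^ n) (at \<theta>)"
proof (induction n rule: induct_nat_012)
  case 0
  have "sin_cdf 0 = (\<lambda>\<theta>. \<theta> / pi)" by auto
  thus ?case by (auto intro!: derivative_eq_intros simp: beta_const_0)
next
  case 1
  have "sin_cdf (Suc 0) = (\<lambda>\<theta>. (1 - cos \<theta>) / 2)" by auto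
  thus ?case by (auto intro!: derivative_eq_intros simp: beta_const_1)
next
  case (ge2 n)
  have e: "sin_cdf (Suc (Suc n)) = (\<lambda>\<theta>. sin_cdf n \<theta> - beta_const n * (cos \<theta> * sin \<theta> ^ Suc n))"
    by (auto simp: mult_ac)
  have "(sin_cdf (Suc (Suc n)) has_real_derivative
      (real n + 1) * beta_const n * sin \<theta> ^ n - beta_const n * (cos \<theta> * ((1 + real n) * (cos \<theta> * sin \<theta> ^ n)) + - sin \<theta> * sin \<theta> ^ Suc n)) (at \<theta>)"
    unfolding e
    by (intro DERIV_diff DERIV_cmult DERIV_mult' ge2 DERIV_cos DERIV_power_Suc DERIV_sin)
  also have "(real n + 1) * beta_const n * sin \<theta> ^ n - beta_const n * (cos \<theta> * ((1 + real n) * (cos \<theta> * sin \<theta> ^ n)) + - sin \<theta> * sin \<theta> ^ Suc n) =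
     ((real n + 2) * beta_const n) * sin \<theta> ^ Suc (Suc n)"
  proof -
    have "s * s + c * c = 1 \<Longrightarrow> (N + 1) * k * p - k * (c * ((1 + N) * (c * p)) + - s * (s * p)) = (N + 2) * k * (s * (s * p))"
      for s c p k N :: real by algebra
    thus ?thesis using sin_cos_squared_add[of \<theta>] by (simp only: power2_eq_square power_Suc)
  qed
  also have "\<dots> = (real (Suc (Suc n)) + 1) * beta_const (Suc (Suc n)) * sin \<theta> ^ Suc (Suc n)"
  proof -
    have "real (Suc (Suc n)) + 1 = real n + 3" by simp
    thus ?thesis by (simp only: beta_const_rec)
  qed
  finally show ?case .
qed

lemma sin_cdf_0: "sin_cdf n 0 = 0"
  by (induction n rule: induct_nat_012) auto

text \<open>Symmetry of the density about pi/2. It gives the value 1 at pi, and it later transfers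
  the hypergeometric form to \<theta> > pi/2, where its 1 becomes the indicator.\<close>

lemma sin_cdf_reflect: "sin_cdf n \<theta> + sin_cdf n (pi - \<theta>) = 1"
  by (induction n rule: induct_nat_012) (auto simp: field_simps)

lemma sin_cdf_pi: "sin_cdf n pi = 1"
  using sin_cdf_reflect[of n 0] by (simp add: sin_cdf_0)

lemma sin_cdf_nonneg:
  assumes "\<theta> \<in> {0..pi}"
  shows "sin_cdf n \<theta> \<ge> 0"
proof -
  have "sin_cdf n 0 \<le> sin_cdf n \<theta>"
  proof (rule DERIV_nonneg_imp_nondecreasing[of 0 \<theta> "sin_cdf n"])
    fix x assume "0 \<le> x" "x \<le> \<theta>"
    hence "(real n + 1) * beta_const n * sin x ^ n \<ge> 0"
      using assms beta_const_pos[of n] by (intro mult_nonneg_nonneg zero_le_power sin_ge_zero) auto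
    thus "\<exists>y. (sin_cdf n has_real_derivative y) (at x) \<and> y \<ge> 0"
      using sin_cdf_has_derivative by blast
  qed (use assms in auto)
  thus ?thesis by (simp add: sin_cdf_0)
qed

lemma montee_weight_odd:
  "sin \<theta> * sin_cdf (2 * k) \<theta> = 1 / pi * \<theta> * sin \<theta> - cos \<theta> * (\<Sum>l = 1..k.
     sin \<theta> ^ (2 * l) * ((Gamma (real l))\<^sup>2 * 2 powi (2 * int l - 2) / (pi * Gamma (2 * real l))))"
proof -
  \<comment> \<open>Term \<open>l\<close> of the sum is the \<open>l\<close>-th unfolding of the
    recursion of \<open>sin_cdf\<close>, hence the shift from \<open>Suc k\<close> to
    \<open>2 * k\<close>.\<close>
  define t where "t = (\<lambda>l. (Gamma (real l))\<^sup>2 * 2 powi (2 * int l - 2) / (pi * Gamma (2 * real l)))"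
  have t: "t (Suc k) = beta_const (2 * k)" for k
  proof -
    have "(2::real) powi (2 * int (Suc k) - 2) = 2 ^ (2 * k)"
      by (simp add: power_int_def nat_mult_distrib)
    moreover have "(real (2 * k) + 2) / 2 = real (Suc k)" "real (2 * k) + 2 = 2 * real (Suc k)"
      by simp_all
    ultimately show ?thesis unfolding beta_const_def t_def by (simp only: mult_ac)
  qed
  have "sin \<theta> * sin_cdf (2 * k) \<theta> = 1 / pi * \<theta> * sin \<theta> - cos \<theta> * (\<Sum>l = 1..k. sin \<theta> ^ (2 * l) * t l)"
    by (induction k) (simp_all add: t algebra_simps)
  thus ?thesis by (simp only: t_def)
qed

lemma montee_weight_even:
  "sin \<theta> * sin_cdf (Suc (2 * k)) \<theta> = 1 / 2 * sin \<theta> - cos \<theta> * (\<Sum>l = 1..Suc k.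
     sin \<theta> ^ (2 * l - 1) * ((Gamma ((2 * real l - 1) / 2))\<^sup>2 * 2 powi (2 * int l - 3) / (pi * Gamma (2 * real l - 1))))"
proof -
  define t where "t = (\<lambda>l. (Gamma ((2 * real l - 1) / 2))\<^sup>2 * 2 powi (2 * int l - 3) / (pi * Gamma (2 * real l - 1)))"
  \<comment> \<open>The term \<open>l = 1\<close> is no recursion step but the cosine in the base
    case of \<open>sin_cdf\<close>; its power of 2 has exponent -1.\<close>
  have t1: "t (Suc 0) = 1 / 2"
    by (simp add: t_def Gamma_one_half_real power_int_minus field_simps)
  have t: "t (Suc (Suc k)) = beta_const (Suc (2 * k))" for k
  proof -
    have "nat (2 * int (Suc (Suc k)) - 3) = Suc (2 * k)" by simp
    hence "(2::real) powi (2 * int (Suc (Suc k)) - 3) = 2 ^ Suc (2 * k)"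
      by (simp add: power_int_def)
    moreover have "real (Suc (2 * k)) + 2 = 2 * real (Suc (Suc k)) - 1" by simp
    ultimately show ?thesis unfolding beta_const_def t_def by (simp only: mult_ac)
  qed
  have "sin \<theta> * sin_cdf (Suc (2 * k)) \<theta> = 1 / 2 * sin \<theta> - cos \<theta> * (\<Sum>l = 1..Suc k. sin \<theta> ^ (2 * l - 1) * t l)"
  proof (induction k)
    case (Suc k)
    have "(\<Sum>l = 1..Suc (Suc k). sin \<theta> ^ (2 * l - 1) * t l) =
        (\<Sum>l = 1..Suc k. sin \<theta> ^ (2 * l - 1) * t l) + sin \<theta> ^ Suc (Suc (Suc (2 * k))) * beta_const (Suc (2 * k))"
      by (simp add: t)
    moreover have "sin_cdf (Suc (2 * Suc k)) \<theta> = sin_cdf (Suc (2 * k)) \<theta> - beta_const (Suc (2 * k)) * cos \<theta> * sin \<theta> ^ Suc (Suc (2 * k))"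
      by simp
    ultimately show ?case using Suc by (simp only: right_diff_distrib distrib_left) (simp add: mult_ac)
  qed (simp add: t1 field_simps)
  thus ?thesis by (simp only: t_def)
qed

lemma montee_weight_eq:
  assumes "d \<ge> 3"
  shows "montee_weight d \<theta> = sin \<theta> * sin_cdf (d - 3) \<theta>"
proof (cases "odd d")
  case True
  then obtain j where "d = 2 * j + 1" by (elim oddE)
  hence "d = 2 * (j - 1) + 3" using assms by simp
  then obtain k where k: "d = 2 * k + 3" by blast
  show ?thesis using montee_weight_odd[of \<theta> k] by (simp add: montee_weight_def k)
next
  case False
  then obtain j where "d = 2 * j" by (auto elim: evenE)
  hence "d = 2 * (j - 2) + 4" using assms by simp
  then obtain k where k: "d = 2 * k + 4" by blast
  have "d - 3 = Suc (2 * k)" "d div 2 - 1 = Suc k" using k by simp_all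
  thus ?thesis using montee_weight_even[of \<theta> k] False by (simp only: montee_weight_def if_False)
qed

text \<open>Integrating by parts moves the derivative onto the distribution function, where only the constant
  term survives: \<open>sin\<^sup>n\<^sup>+\<^sup>1 \<theta> R\<^sub>k(cos \<theta>)\<close> is an explicit primitive of the part orthogonal to it.\<close>

lemma orthogonality_primitive:
  assumes l: "l = (real n + 2) / 2" and l': "l' = real n / 2"
  shows "((\<lambda>\<beta>. sin \<beta> ^ Suc n * norm_gegenbauer l k (cos \<beta>)) has_real_derivative
           (real n + 1) * sin \<beta> ^ n * norm_gegenbauer l' (Suc k) (cos \<beta>)) (at \<beta>)"
proof -
  have l0: "l \<ge> 0" "l' \<ge> 0" "l = l' + 1" using assms by (simp_all add: field_simps)
  define t where "t = cos \<beta>"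
  \<comment> \<open>The derivative of the polynomial at \<open>t\<close>. The inner derivative -sin
    joins sin^(n+1), so \<open>D\<close> enters only through (1 - t^2) D, which
    \<open>norm_gegenbauer_ode\<close> expresses without derivatives.\<close>
  define D where "D = real k * (real k + 2 * l) / (1 + 2 * l) * norm_gegenbauer (l + 1) (k - 1) t"
  have D: "(1 - t\<^sup>2) * D = real k * (norm_gegenbauer l (k - 1) t - t * norm_gegenbauer l k t)"
  proof (cases k)
    case (Suc j)
    have "(1 + 2 * l) * ((1 - t\<^sup>2) * D) = real k * ((1 - t\<^sup>2) * (real (Suc j) + 2 * l) * norm_gegenbauer (l + 1) j t)"
      using l0(1) by (simp add: D_def Suc)
    also have "\<dots> = (1 + 2 * l) * (real k * (norm_gegenbauer l (k - 1) t - t * norm_gegenbauer l k t))"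
      unfolding norm_gegenbauer_ode[OF l0(1)] by (simp add: Suc)
    finally show ?thesis using l0(1) by (subst (asm) mult_left_cancel) auto
  qed (simp add: D_def)
  have J: "(2 * l' + 1) * norm_gegenbauer l' (Suc k) t = (2 * l' + 1 + real k) * t * norm_gegenbauer l k t - real k * norm_gegenbauer l (k - 1) t"
    using norm_gegenbauer_Suc_index[OF l0(2), of k t] by (simp add: l0(3))
  have "((\<lambda>\<beta>. sin \<beta> ^ Suc n * norm_gegenbauer l k (cos \<beta>)) has_real_derivative
     sin \<beta> ^ Suc n * (D * - sin \<beta>) + (1 + real n) * (cos \<beta> * sin \<beta> ^ n) * norm_gegenbauer l k (cos \<beta>)) (at \<beta>)"
    unfolding D_def t_def
    by (intro DERIV_mult' DERIV_power_Suc DERIV_sin DERIV_chain2[OF norm_gegenbauer_has_derivative[OF l0(1)]] DERIV_cos)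
  also have "sin \<beta> ^ Suc n * (D * - sin \<beta>) + (1 + real n) * (cos \<beta> * sin \<beta> ^ n) * norm_gegenbauer l k (cos \<beta>) =
     sin \<beta> ^ n * ((real n + 1) * t * norm_gegenbauer l k t - (sin \<beta>)\<^sup>2 * D)"
    by (simp add: t_def power2_eq_square algebra_simps)
  also have "(sin \<beta>)\<^sup>2 = 1 - t\<^sup>2" by (simp add: t_def sin_squared_eq)
  also have "(real n + 1) * t * norm_gegenbauer l k t - (1 - t\<^sup>2) * D = (real n + 1) * norm_gegenbauer l' (Suc k) t"
    using J D unfolding l' by (simp add: algebra_simps)
  finally show ?thesis by (simp add: t_def mult_ac)
qed

section \<open>c(d) as an integral against the weight, and its sign for nonnegative
  functions\<close>

lemma has_integral_weight_norm_gegenbauer: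
  assumes d: "d \<ge> 3"
  shows "((\<lambda>\<beta>. montee_weight d \<beta> * norm_gegenbauer ((real d - 1) / 2) k (cos \<beta>)) has_integral
           montee_coeff d k * (-1) ^ k) {0..pi}"
proof -
  define n where "n = d - 3"
  have dn: "d = n + 3" using d by (simp add: n_def)
  define q where "q = montee_coeff d k"
  define P where "P = norm_gegenbauer ((real d - 3) / 2) (Suc k)"
  define R where "R = norm_gegenbauer ((real d - 1) / 2) k"
  have l0: "(real d - 3) / 2 \<ge> 0" using d by simp
  \<comment> \<open>The first summand is the boundary term of the integration by parts; its
    derivative contains an unwanted multiple of P sin^n, which the second summand cancels. The
    second vanishes at both ends, the first at 0, so only the value at pi remains.\<close>
  define F where "F = (\<lambda>\<beta>. (- q * P (cos \<beta>)) * sin_cdf n \<beta> + q * beta_const n * (sin \<beta> ^ Suc n * R (cos \<beta>)))"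
  have "(F has_real_derivative montee_weight d \<beta> * R (cos \<beta>)) (at \<beta>)" for \<beta>
  proof -
    have "((\<lambda>\<beta>. sin \<beta> ^ Suc n * R (cos \<beta>)) has_real_derivative (real n + 1) * sin \<beta> ^ n * P (cos \<beta>)) (at \<beta>)"
      unfolding R_def P_def by (rule orthogonality_primitive) (simp_all add: dn)
    hence "(F has_real_derivative
       (- q * P (cos \<beta>)) * ((real n + 1) * beta_const n * sin \<beta> ^ n) + (sin \<beta> * R (cos \<beta>)) * sin_cdf n \<beta>
       + q * beta_const n * ((real n + 1) * sin \<beta> ^ n * P (cos \<beta>))) (at \<beta>)"
      unfolding F_def q_def P_def R_def
      by (intro DERIV_add DERIV_mult' DERIV_cmult sin_cdf_has_derivative norm_gegenbauer_cos_primitive[OF d]) 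
    thus ?thesis
      by (simp add: montee_weight_eq[OF d] n_def[symmetric] algebra_simps)
  qed
  hence "((\<lambda>\<beta>. montee_weight d \<beta> * R (cos \<beta>)) has_integral F pi - F 0) {0..pi}"
    by (intro fundamental_theorem_of_calculus)
       (auto simp flip: has_real_derivative_iff_has_vector_derivative intro: has_field_derivative_at_within)
  moreover have "P (- 1) = - ((-1) ^ k)"
    using norm_gegenbauer_minus[of "(real d - 3) / 2" "Suc k" 1] norm_gegenbauer_1[OF l0, of "Suc k"] by (simp add: P_def)
  hence "F pi - F 0 = q * (-1) ^ k"
    by (simp add: F_def sin_cdf_0 sin_cdf_pi)
  ultimately show ?thesis by (simp add: q_def R_def)
qed

lemma continuous_on_montee_weight: "d \<ge> 3 \<Longrightarrow> continuous_on A (montee_weight d)"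
proof -
  assume d: "d \<ge> 3"
  have "continuous_on A (sin_cdf n)" for n
    by (intro continuous_at_imp_continuous_on ballI DERIV_isCont[OF sin_cdf_has_derivative])
  hence "continuous_on A (\<lambda>\<theta>. sin \<theta> * sin_cdf (d - 3) \<theta>)"
    by (intro continuous_intros)
  moreover have "montee_weight d = (\<lambda>\<theta>. sin \<theta> * sin_cdf (d - 3) \<theta>)"
    by (simp add: fun_eq_iff montee_weight_eq[OF d])
  ultimately show ?thesis by simp
qed

lemma schoenberg_c_eq_integral:
  assumes d: "d \<ge> 3" and S: "has_schoenberg_seq d \<psi> b"
  shows "schoenberg_c d b = integral {0..pi} (\<lambda>\<theta>. montee_weight d \<theta> * \<psi> \<theta>)"
proof -
  have "(\<lambda>n. b n * (montee_coeff d n * (-1) ^ n)) sums integral {0..pi} (\<lambda>\<beta>. montee_weight d \<beta> * \<psi> \<beta>)"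
    by (rule norm_gegenbauer_series_integral[OF _ coeffs_abs_summable[OF d S] _ schoenberg_series[OF d S]
          continuous_on_montee_weight[OF d] has_integral_weight_norm_gegenbauer[OF d]]) (use d in auto)
  with schoenberg_c_sums[OF d S] show ?thesis by (rule sums_unique2)
qed

lemma schoenberg_c_nonneg:
  assumes d: "d \<ge> 3" and S: "has_schoenberg_seq d \<psi> b" and nn: "\<forall>\<theta>\<in>{0..pi}. \<psi> \<theta> \<ge> 0"
  shows "schoenberg_c d b \<ge> 0"
  unfolding schoenberg_c_eq_integral[OF d S]
proof (rule integral_nonneg)
  show "(\<lambda>\<theta>. montee_weight d \<theta> * \<psi> \<theta>) integrable_on {0..pi}"
    by (intro integrable_continuous_real continuous_intros continuous_on_montee_weight[OF d] schoenberg_continuous[OF d S])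
  show "0 \<le> montee_weight d \<theta> * \<psi> \<theta>" if "\<theta> \<in> {0..pi}" for \<theta>
    using that nn sin_cdf_nonneg[OF that] by (auto simp: montee_weight_eq[OF d] sin_ge_zero)
qed

subsection \<open>Hypergeometric form of the weight\<close>

text \<open>The upper parameter 1 cancels the factorial, and \<open>a \<le> c\<close> puts the
  remaining quotients between 0 and 1, so a geometric series dominates.\<close>

lemma hypergeometric_1_sums:
  fixes a c z :: real
  assumes "0 < a" "a \<le> c" "\<bar>z\<bar> < 1"
  shows "(\<lambda>k. pochhammer a k / pochhammer c k * z ^ k) sums hypergeometric_2F1 1 a c z"
proof -
  have "fps_nth (fps_hypergeo [1, a] [c] 1) k = pochhammer a k / pochhammer c k" for k
    by (simp add: pochhammer_fact[symmetric])
  moreover have "summable (\<lambda>k. pochhammer a k / pochhammer c k * z ^ k)"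
  proof (rule summable_comparison_test')
    show "summable (\<lambda>k. \<bar>z\<bar> ^ k)" using assms by (simp add: summable_geometric)
    fix k
    have "0 < pochhammer a k" "0 < pochhammer c k" using assms by (auto intro: pochhammer_pos)
    moreover have "pochhammer a k \<le> pochhammer c k"
      unfolding pochhammer_prod using assms by (intro prod_mono) auto
    ultimately have "0 \<le> pochhammer a k / pochhammer c k" "pochhammer a k / pochhammer c k \<le> 1"
      by (auto simp: divide_le_eq)
    hence "\<bar>pochhammer a k / pochhammer c k\<bar> \<le> 1" by (simp only: abs_of_nonneg)
    hence "\<bar>pochhammer a k / pochhammer c k\<bar> * \<bar>z\<bar> ^ k \<le> 1 * \<bar>z\<bar> ^ k"
      by (rule mult_right_mono) simp
    thus "norm (pochhammer a k / pochhammer c k * z ^ k) \<le> \<bar>z\<bar> ^ k"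
      by (simp only: real_norm_def abs_mult power_abs mult_1)
  qed
  ultimately show ?thesis
    by (simp only: hypergeometric_2F1_def eval_fps_def summable_sums)
qed

text \<open>A first-order equation, since consecutive coefficients satisfy (c + k) u_(k+1) = (a + k)
  u_k; the inhomogeneous term c - 1 is the degree 0 term lost in the index shift.\<close>

lemma hypergeometric_1_ode:
  fixes a c z :: real
  assumes ac: "0 < a" "a \<le> c" and z: "\<bar>z\<bar> < 1"
  defines "F \<equiv> hypergeometric_2F1 1 a c"
  shows "\<exists>F'. (F has_real_derivative F') (at z) \<and> z * (1 - z) * F' = (c - 1) - (c - 1) * F z + a * z * F z"
proof -
  define u where "u = (\<lambda>k. pochhammer a k / pochhammer c k)"
  have F: "(\<lambda>k. u k * x ^ k) sums F x" if "\<bar>x\<bar> < 1" for x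
    unfolding F_def u_def by (rule hypergeometric_1_sums[OF ac that])
  define F' where "F' = (\<Sum>k. diffs u k * z ^ k)"
  have sm: "summable (\<lambda>k. u k * x ^ k)" if "norm x < 1" for x
    using F[of x] that by (intro sums_summable[of _ "F x"]) simp
  have "((\<lambda>x. \<Sum>k. u k * x ^ k) has_real_derivative F') (at z)"
    unfolding F'_def by (rule termdiffs_strong'[where K = 1]) (use z sm in auto)
  moreover have "eventually (\<lambda>x. (\<Sum>k. u k * x ^ k) = F x) (nhds z)"
  proof -
    have "eventually (\<lambda>x. x \<in> {-1<..<1}) (nhds z)"
      using z by (intro eventually_nhds_in_open) (auto simp: abs_less_iff)
    thus ?thesis
    proof eventually_elim
      case (elim x)
      hence "\<bar>x\<bar> < 1" by (simp add: abs_less_iff)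
      from F[OF this] show ?case by (rule sums_unique[symmetric])
    qed
  qed
  ultimately have D: "(F has_real_derivative F') (at z)"
    by (subst (asm) DERIV_cong_ev) auto
  have "(\<lambda>k. diffs u k * z ^ k) sums F'"
    unfolding F'_def by (rule summable_sums, rule termdiff_converges[where K = 1]) (use z sm in auto)
  hence "(\<lambda>k. z * (diffs u k * z ^ k)) sums (z * F')" by (rule sums_mult)
  hence "(\<lambda>k. (real (Suc k) * u (Suc k)) * z ^ Suc k) sums (z * F')"
    by (simp add: diffs_def mult_ac)
  hence zF': "(\<lambda>k. (real k * u k) * z ^ k) sums (z * F')"
    by (subst (asm) sums_Suc_iff) simp
  have "(\<lambda>k. z * ((real k * u k) * z ^ k + a * (u k * z ^ k))) sums (z * (z * F' + a * F z))"
    by (intro sums_mult sums_add zF' F[OF z])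
  moreover have "z * ((real k * u k) * z ^ k + a * (u k * z ^ k)) =
      (real (Suc k) * u (Suc k)) * z ^ Suc k + (c - 1) * (u (Suc k) * z ^ Suc k)" for k
  proof -
    have "pochhammer c k > 0" using ac by (intro pochhammer_pos) auto
    hence "(c + real k) * u (Suc k) = (a + real k) * u k"
      using ac by (simp add: u_def pochhammer_Suc divide_simps)
    hence "z ^ Suc k * ((c + real k) * u (Suc k)) = z ^ Suc k * ((a + real k) * u k)" by simp
    thus ?thesis by (simp add: algebra_simps)
  qed
  ultimately have 1: "(\<lambda>k. (real (Suc k) * u (Suc k)) * z ^ Suc k + (c - 1) * (u (Suc k) * z ^ Suc k)) sums
      (z * (z * F' + a * F z))" by simp
  have "(\<lambda>k. (real k * u k) * z ^ k + (c - 1) * (u k * z ^ k)) sums (z * F' + (c - 1) * F z)"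
    by (intro sums_mult sums_add zF' F[OF z])
  hence "(\<lambda>k. (real (Suc k) * u (Suc k)) * z ^ Suc k + (c - 1) * (u (Suc k) * z ^ Suc k)) sums
      (z * F' + (c - 1) * F z - (c - 1))"
    using sums_Suc_iff[of "\<lambda>k. (real k * u k) * z ^ k + (c - 1) * (u k * z ^ k)"] by (simp add: u_def)
  from sums_unique2[OF 1 this] have "z * (1 - z) * F' = (c - 1) - (c - 1) * F z + a * z * F z"
    by (simp add: algebra_simps)
  with D show ?thesis by blast
qed

text \<open>Both sides vanish at 0. With z = sin^2, \<open>hypergeometric_1_ode\<close> collapses
  the derivative of cos sin^(n+1) F(sin^2) to (n + 1) sin^n, as required by
  \<open>sin_cdf_has_derivative\<close>. The series demands sin^2 < 1, hence the restriction to
  \<theta> < pi/2.\<close>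

lemma sin_cdf_hypergeometric_less:
  fixes n :: nat
  defines "F \<equiv> hypergeometric_2F1 1 ((real n + 2) / 2) ((real n + 3) / 2)"
  assumes \<theta>: "0 \<le> \<theta>" "\<theta> < pi / 2"
  shows "sin_cdf n \<theta> = beta_const n * (cos \<theta> * sin \<theta> ^ Suc n * F ((sin \<theta>)\<^sup>2))"
proof -
  define h where "h = (\<lambda>\<theta>. cos \<theta> * sin \<theta> ^ Suc n * F ((sin \<theta>)\<^sup>2))"
  have D: "(h has_real_derivative (real n + 1) * sin x ^ n) (at x)" if x: "x \<in> {0..<pi/2}" for x
  proof -
    define s where "s = sin x"
    define c where "c = cos x"
    have "0 < cos x" using x by (intro cos_gt_zero_pi) auto
    hence "(cos x)\<^sup>2 > 0" by simp
    hence "(sin x)\<^sup>2 < 1" using sin_cos_squared_add[of x] by linarith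
    hence "\<bar>s\<^sup>2\<bar> < 1" by (simp add: s_def)
    then obtain F' where F': "(F has_real_derivative F') (at (s\<^sup>2))"
      "s\<^sup>2 * (1 - s\<^sup>2) * F' = ((real n + 3) / 2 - 1) - ((real n + 3) / 2 - 1) * F (s\<^sup>2) + (real n + 2) / 2 * s\<^sup>2 * F (s\<^sup>2)"
      using hypergeometric_1_ode[of "(real n + 2) / 2" "(real n + 3) / 2" "s\<^sup>2", folded F_def] by force
    have sq: "((\<lambda>x. (sin x)\<^sup>2) has_real_derivative 2 * s * c) (at x)"
      unfolding s_def c_def by (auto intro!: derivative_eq_intros)
    have "(h has_real_derivative
       (c * s ^ Suc n) * (F' * (2 * s * c)) + (c * ((1 + real n) * (c * s ^ n)) + - s * s ^ Suc n) * F (s\<^sup>2)) (at x)"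
      unfolding h_def s_def c_def
      by (intro DERIV_mult' DERIV_cos DERIV_power_Suc DERIV_sin DERIV_chain2[of F] F'(1)[unfolded s_def] sq[unfolded s_def c_def])
    also have "(c * s ^ Suc n) * (F' * (2 * s * c)) + (c * ((1 + real n) * (c * s ^ n)) + - s * s ^ Suc n) * F (s\<^sup>2) =
        s ^ n * (2 * (s\<^sup>2 * c\<^sup>2 * F') + (1 + real n) * c\<^sup>2 * F (s\<^sup>2) - s\<^sup>2 * F (s\<^sup>2))"
      by (simp add: power2_eq_square algebra_simps)
    also have "c\<^sup>2 = 1 - s\<^sup>2" by (simp add: s_def c_def cos_squared_eq)
    also have "2 * (s\<^sup>2 * (1 - s\<^sup>2) * F') + (1 + real n) * (1 - s\<^sup>2) * F (s\<^sup>2) - s\<^sup>2 * F (s\<^sup>2) = real n + 1"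
      unfolding F'(2) by (simp add: field_simps)
    finally show ?thesis by (simp add: s_def mult_ac)
  qed
  have "\<exists>k. \<forall>x\<in>{0..<pi/2}. sin_cdf n x - beta_const n * h x = k"
  proof (rule has_field_derivative_zero_constant)
    fix x assume x: "x \<in> {0..<pi/2}"
    have "((\<lambda>x. sin_cdf n x - beta_const n * h x) has_real_derivative
       (real n + 1) * beta_const n * sin x ^ n - beta_const n * ((real n + 1) * sin x ^ n)) (at x)"
      by (intro DERIV_diff DERIV_cmult D[OF x] sin_cdf_has_derivative)
    thus "((\<lambda>x. sin_cdf n x - beta_const n * h x) has_real_derivative 0) (at x within {0..<pi/2})"
      by - (rule has_field_derivative_at_within, simp add: mult_ac)
  qed auto
  then obtain k where k: "\<And>x. x \<in> {0..<pi/2} \<Longrightarrow> sin_cdf n x - beta_const n * h x = k" by blast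
  have "k = 0" using k[of 0] by (simp add: sin_cdf_0 h_def)
  with k[of \<theta>] \<theta> show ?thesis by (simp add: h_def)
qed

lemma montee_weight_hypergeometric:
  assumes d: "d \<ge> 3" and \<theta>: "\<theta> \<in> {0..pi} - {pi / 2}"
  shows "montee_weight d \<theta> = sin \<theta> * of_bool (\<theta> > pi / 2)
    + 2 ^ (d - 3) * (Gamma ((real d - 1) / 2))\<^sup>2 / (pi * Gamma (real d - 1)) * cos \<theta> * sin \<theta> ^ (d - 1)
      * hypergeometric_2F1 1 ((real d - 1) / 2) (real d / 2) ((sin \<theta>)\<^sup>2)"
proof -
  define n where "n = d - 3"
  have dn: "d = n + 3" using d by (simp add: n_def)
  have e: "real d - 1 = real n + 2" "real d = real n + 3" "d - 1 = Suc (Suc n)" by (simp_all add: dn)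
  define F where "F = hypergeometric_2F1 1 ((real n + 2) / 2) ((real n + 3) / 2) ((sin \<theta>)\<^sup>2)"
  have "sin_cdf n \<theta> = of_bool (\<theta> > pi / 2) + beta_const n * (cos \<theta> * sin \<theta> ^ Suc n * F)"
  proof (cases "\<theta> < pi / 2")
    case True
    thus ?thesis using sin_cdf_hypergeometric_less[of \<theta> n] \<theta> by (simp add: F_def)
  next
    case False
    hence "pi / 2 < \<theta>" using \<theta> by auto
    thus ?thesis
      using sin_cdf_hypergeometric_less[of "pi - \<theta>" n] sin_cdf_reflect[of n \<theta>] \<theta> by (simp add: F_def)
  qed
  hence "montee_weight d \<theta> = sin \<theta> * (of_bool (\<theta> > pi / 2) + beta_const n * (cos \<theta> * sin \<theta> ^ Suc n * F))"
    by (simp add: montee_weight_eq[OF d] n_def)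
  thus ?thesis
    unfolding e F_def n_def[symmetric] beta_const_def by (simp add: algebra_simps)
qed

theorem proposition3p3:
  fixes d :: nat and \<psi> :: "real \<Rightarrow> real" and b :: "nat \<Rightarrow> real"
  assumes "d \<ge> 3"
    and "\<psi> \<in> Psi d"
    and "has_schoenberg_seq d \<psi> b"
  shows
    "(montee_well_defined \<psi> \<and> montee \<psi> \<in> Psi (d - 2) \<longleftrightarrow> schoenberg_c d b \<ge> 0) \<and>
     (schoenberg_c d b \<ge> 0 \<longrightarrow> has_schoenberg_seq (d - 2) (montee \<psi>) (montee_seq d b)) \<and>
     (schoenberg_c d b \<ge> 0 \<longleftrightarrow> integral {0..pi} (\<lambda>\<theta>. montee_weight d \<theta> * \<psi> \<theta>) \<ge> 0) \<and>
     (\<forall>\<theta>\<in>{0..pi} - {pi / 2}.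
        montee_weight d \<theta> =
          sin \<theta> * of_bool (\<theta> > pi / 2)
          + 2 ^ (d - 3) * (Gamma ((real d - 1) / 2))\<^sup>2 / (pi * Gamma (real d - 1))
            * cos \<theta> * sin \<theta> ^ (d - 1)
            * hypergeometric_2F1 1 ((real d - 1) / 2) (real d / 2) ((sin \<theta>)\<^sup>2)) \<and>
     ((\<forall>\<theta>\<in>{0..pi}. \<psi> \<theta> \<ge> 0) \<longrightarrow> schoenberg_c d b \<ge> 0)"
proof (intro conjI impI ballI)
  show "montee_well_defined \<psi> \<and> montee \<psi> \<in> Psi (d - 2) \<longleftrightarrow> schoenberg_c d b \<ge> 0"
    by (rule montee_in_Psi_iff[OF assms(1,3)])
  show "has_schoenberg_seq (d - 2) (montee \<psi>) (montee_seq d b)" if "schoenberg_c d b \<ge> 0"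
    by (rule montee_has_schoenberg_seq[OF assms(1,3) that])
  show "schoenberg_c d b \<ge> 0 \<longleftrightarrow> integral {0..pi} (\<lambda>\<theta>. montee_weight d \<theta> * \<psi> \<theta>) \<ge> 0"
    by (simp only: schoenberg_c_eq_integral[OF assms(1,3)])
  show "montee_weight d \<theta> =
          sin \<theta> * of_bool (\<theta> > pi / 2)
          + 2 ^ (d - 3) * (Gamma ((real d - 1) / 2))\<^sup>2 / (pi * Gamma (real d - 1))
            * cos \<theta> * sin \<theta> ^ (d - 1)
            * hypergeometric_2F1 1 ((real d - 1) / 2) (real d / 2) ((sin \<theta>)\<^sup>2)"
    if "\<theta> \<in> {0..pi} - {pi / 2}" for \<theta>
    by (rule montee_weight_hypergeometric[OF assms(1) that])
  show "schoenberg_c d b \<ge> 0" if "\<forall>\<theta>\<in>{0..pi}. \<psi> \<theta> \<ge> 0"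
    by (rule schoenberg_c_nonneg[OF assms(1,3) that])
qed

end
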